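(* Let $n\in\mathbb N$, $2\le q<\infty$, $1\le p\le q$ with conjugate exponent $p'$, and let $m\ge4$ be even with $n\le m^q$. For every $N\in\mathbb N$ and every $g\in L_{p'}(G_{m,n}\times[n];\ell_\infty^N)$ there exists $h\in L_{p'}(G_{m,n}\times\Sigma_n;\ell_\infty^N)$ such that $$D_{\mathrm{sgn}}^*h=\frac{n^{1/q}}{m}D_{\mathrm{long}}^*g,\qquad \|h\|_{L_{p'}(G_{m,n}\times\Sigma_n;\ell_\infty^N)}\le22\,\|g\|_{L_{p'}(G_{m,n}\times[n];\ell_\infty^N)}.$$ The least regular norm of a scalar linear operator $S:L_{p'}(G_{m,n}\times[n])\to L_{p'}(G_{m,n}\times\Sigma_n)$ satisfying $D_{\mathrm{sgn}}^*S=\frac{n^{1/q}}{m}D_{\mathrm{long}}^*$ is $n^{1/q}$. In particular, for $p=q=2$ this least regular norm is $\sqrt n$, whereas the nonlinear lifting bound above is at most $22$.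
   Context: All spaces are real; $\mathbb N=\{1,2,\ldots\}$; $[n]=\{1,\ldots,n\}$; $p'=\infty$ when $p=1$. Let $G_{m,n}=(\mathbb Z/(2m\mathbb Z))^n$ and $\Sigma_n=\{-1,1\}^n$. Let $e_j$ be the $j$-th standard basis vector; additions in $G_{m,n}$ are modulo $2m$. For a finite nonempty set $\Omega$, a Banach space $Y$ and $1\le r<\infty$, $L_r(\Omega;Y)$ is the space of all maps $F:\Omega\to Y$ with $\|F\|_{L_r(\Omega;Y)}=\bigl(|\Omega|^{-1}\sum_{\omega\in\Omega}\|F(\omega)\|_Y^r\bigr)^{1/r}$; for $r=\infty$ the norm is the maximum of $\|F(\omega)\|_Y$. $L_r(\Omega)=L_r(\Omega;\mathbb R)$. For $Y=\mathbb R$ or $Y=\ell_\infty^N$ and $g:G_{m,n}\times[n]\to Y$, $h:G_{m,n}\times\Sigma_n\to Y$, define functions $G_{m,n}\to Y$ by $$D_{\mathrm{long}}^*g(x)=\frac1n\sum_{j=1}^n\bigl(g(x-me_j,j)-g(x,j)\bigr),\qquad D_{\mathrm{sgn}}^*h(x)=2^{-n}\sum_{\varepsilon\in\Sigma_n}\bigl(h(x-\varepsilon,\varepsilon)-h(x,\varepsilon)\bigr).$$ For a linear operator $R:L_r(\Omega)\to L_r(\Omega')$ between such finite scalar spaces, $1\le r\le\infty$, its regular norm is $\|R\|_{\mathrm{reg}}=\sup_{N\ge1}\|R\otimes I_{\ell_\infty^N}\|$, where $R\otimes I_{\ell_\infty^N}:L_r(\Omega;\ell_\infty^N)\to L_r(\Omega';\ell_\infty^N)$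 acts by the same scalar matrix as $R$ (i.e. coordinatewise), and the norm is the operator norm. *)

theory Defs
  imports Complex_Main "HOL-Library.Extended_Real" "HOL-Algebra.Product_Groups"
begin

definition torus :: "nat \<Rightarrow> nat \<Rightarrow> (nat \<Rightarrow> int) monoid" where
  "torus m n = product_group {1..n} (\<lambda>_. integer_mod_group (2 * m))"

definition torus_of :: "nat \<Rightarrow> nat \<Rightarrow> (nat \<Rightarrow> int) \<Rightarrow> nat \<Rightarrow> int" where
  "torus_of m n v = (\<lambda>i\<in>{1..n}. v i mod (2 * int m))"

definition torus_sub :: "nat \<Rightarrow> nat \<Rightarrow> (nat \<Rightarrow> int) \<Rightarrow> (nat \<Rightarrow> int) \<Rightarrow> nat \<Rightarrow> int" where
  "torus_sub m n x v = x \<otimes>\<^bsub>torus m n\<^esub> inv\<^bsub>torus m n\<^esub> (torus_of m n v)"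

definition signs :: "nat \<Rightarrow> (nat \<Rightarrow> int) set" where
  "signs n = ({1..n} \<rightarrow>\<^sub>E {-1, 1})"

definition std_basis :: "nat \<Rightarrow> nat \<Rightarrow> int" where
  "std_basis j = (\<lambda>i. if i = j then 1 else 0)"

abbreviation long_dom :: "nat \<Rightarrow> nat \<Rightarrow> ((nat \<Rightarrow> int) \<times> nat) set" where
  "long_dom m n \<equiv> carrier (torus m n) \<times> {1..n}"

abbreviation sgn_dom :: "nat \<Rightarrow> nat \<Rightarrow> ((nat \<Rightarrow> int) \<times> (nat \<Rightarrow> int)) set" where
  "sgn_dom m n \<equiv> carrier (torus m n) \<times> signs n"

definition D_long_adj ::
  "nat \<Rightarrow> nat \<Rightarrow> ((nat \<Rightarrow> int) \<times> nat \<Rightarrow> real) \<Rightarrow> (nat \<Rightarrow> int) \<Rightarrow> real" where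
  "D_long_adj m n g x =
     1 / real n * (\<Sum>j\<in>{1..n}. g (torus_sub m n x (\<lambda>i. int m * std_basis j i), j) - g (x, j))"

definition D_sgn_adj ::
  "nat \<Rightarrow> nat \<Rightarrow> ((nat \<Rightarrow> int) \<times> (nat \<Rightarrow> int) \<Rightarrow> real) \<Rightarrow> (nat \<Rightarrow> int) \<Rightarrow> real" where
  "D_sgn_adj m n h x =
     1 / 2 ^ n * (\<Sum>\<epsilon>\<in>signs n. h (torus_sub m n x \<epsilon>, \<epsilon>) - h (x, \<epsilon>))"

(* A vector of l_infty^N is a function on nat of which only the coordinates 1..N matter (N >= 1).
   Likewise a map Omega -> l_infty^N is a function on the ambient type of which only the values
   on Omega matter. *)

definition linf_norm :: "nat \<Rightarrow> (nat \<Rightarrow> real) \<Rightarrow> real" where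
  "linf_norm N y = Max ((\<lambda>i. \<bar>y i\<bar>) ` {1..N})"

definition Lr_norm :: "ereal \<Rightarrow> nat \<Rightarrow> 'a set \<Rightarrow> ('a \<Rightarrow> nat \<Rightarrow> real) \<Rightarrow> real" where
  "Lr_norm r N \<Omega> F =
     (if r = \<infinity> then Max ((\<lambda>\<omega>. linf_norm N (F \<omega>)) ` \<Omega>)
      else (1 / real (card \<Omega>) * (\<Sum>\<omega>\<in>\<Omega>. linf_norm N (F \<omega>) powr real_of_ereal r))
             powr (1 / real_of_ereal r))"

definition conj_exponent :: "real \<Rightarrow> ereal" where
  "conj_exponent p = (if p = 1 then \<infinity> else ereal (p / (p - 1)))"

(* The first conjunct says that R descends to a map between the spaces of scalar functions
   on Omega and Omega', functions being identified when they agree there. *)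
definition linear_operator_on ::
  "'a set \<Rightarrow> 'b set \<Rightarrow> (('a \<Rightarrow> real) \<Rightarrow> 'b \<Rightarrow> real) \<Rightarrow> bool" where
  "linear_operator_on \<Omega> \<Omega>' R \<longleftrightarrow>
     (\<forall>f g. (\<forall>\<omega>\<in>\<Omega>. f \<omega> = g \<omega>) \<longrightarrow> (\<forall>\<omega>'\<in>\<Omega>'. R f \<omega>' = R g \<omega>')) \<and>
     (\<forall>f g. \<forall>\<omega>'\<in>\<Omega>'. R (\<lambda>\<omega>. f \<omega> + g \<omega>) \<omega>' = R f \<omega>' + R g \<omega>') \<and>
     (\<forall>c f. \<forall>\<omega>'\<in>\<Omega>'. R (\<lambda>\<omega>. c * f \<omega>) \<omega>' = c * R f \<omega>')"

(* R tensor the identity of l_infty^N, for every N at once *)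
definition coordinatewise ::
  "(('a \<Rightarrow> real) \<Rightarrow> 'b \<Rightarrow> real) \<Rightarrow> ('a \<Rightarrow> nat \<Rightarrow> real) \<Rightarrow> 'b \<Rightarrow> nat \<Rightarrow> real" where
  "coordinatewise R F = (\<lambda>\<omega>' i. R (\<lambda>\<omega>. F \<omega> i) \<omega>')"

definition operator_norm ::
  "ereal \<Rightarrow> nat \<Rightarrow> 'a set \<Rightarrow> 'b set \<Rightarrow> (('a \<Rightarrow> nat \<Rightarrow> real) \<Rightarrow> 'b \<Rightarrow> nat \<Rightarrow> real) \<Rightarrow> ereal" where
  "operator_norm r N \<Omega> \<Omega>' T = (SUP F\<in>{F. Lr_norm r N \<Omega> F \<le> 1}. ereal (Lr_norm r N \<Omega>' (T F)))"

definition regular_norm ::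
  "ereal \<Rightarrow> 'a set \<Rightarrow> 'b set \<Rightarrow> (('a \<Rightarrow> real) \<Rightarrow> 'b \<Rightarrow> real) \<Rightarrow> ereal" where
  "regular_norm r \<Omega> \<Omega>' R = (SUP N\<in>{1..}. operator_norm r N \<Omega> \<Omega>' (coordinatewise R))"

definition bounded_lifting :: "nat \<Rightarrow> nat \<Rightarrow> real \<Rightarrow> ereal \<Rightarrow> real \<Rightarrow> bool" where
  "bounded_lifting m n q r C \<longleftrightarrow>
     (\<forall>N\<ge>1. \<forall>g :: (nat \<Rightarrow> int) \<times> nat \<Rightarrow> nat \<Rightarrow> real.
        \<exists>h :: (nat \<Rightarrow> int) \<times> (nat \<Rightarrow> int) \<Rightarrow> nat \<Rightarrow> real.
          (\<forall>x\<in>carrier (torus m n). \<forall>i\<in>{1..N}.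
             D_sgn_adj m n (\<lambda>\<omega>. h \<omega> i) x =
               real n powr (1 / q) / real m * D_long_adj m n (\<lambda>\<omega>. g \<omega> i) x) \<and>
          Lr_norm r N (sgn_dom m n) h \<le> C * Lr_norm r N (long_dom m n) g)"

definition linear_lifting ::
  "nat \<Rightarrow> nat \<Rightarrow> real \<Rightarrow>
     (((nat \<Rightarrow> int) \<times> nat \<Rightarrow> real) \<Rightarrow> (nat \<Rightarrow> int) \<times> (nat \<Rightarrow> int) \<Rightarrow> real) \<Rightarrow> bool" where
  "linear_lifting m n q S \<longleftrightarrow>
     linear_operator_on (long_dom m n) (sgn_dom m n) S \<and>
     (\<forall>g. \<forall>x\<in>carrier (torus m n).
        D_sgn_adj m n (S g) x = real n powr (1 / q) / real m * D_long_adj m n g x)"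

definition least_regular_norm_of_linear_lifting ::
  "nat \<Rightarrow> nat \<Rightarrow> real \<Rightarrow> ereal \<Rightarrow> ereal \<Rightarrow> bool" where
  "least_regular_norm_of_linear_lifting m n q r c \<longleftrightarrow>
     (\<exists>S. linear_lifting m n q S \<and> regular_norm r (long_dom m n) (sgn_dom m n) S = c) \<and>
     (\<forall>S. linear_lifting m n q S \<longrightarrow> c \<le> regular_norm r (long_dom m n) (sgn_dom m n) S)"

end

theory Submission
  imports Defs "HOL-Analysis.Convex"
begin

text \<open>Both halves are statements about transporting mass on the torus. A function h on the sign edges
(x, x + \<epsilon>) is a flow whose net inflow is the sign divergence of h, and the long divergence of g is a
demand: each long edge asks to carry g(x, j) from x to x + m e_j.

\<^bold>\<open>Nonlinear lifting.\<close> Let w(x, j) be the sup norm of g(x, j). It suffices to find capacities W on the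
sign edges, depending on w only and with the norm of W at most 22 times that of w, such that every scalar
demand with |g| \<le> w is met by a flow with |h| \<le> W; the coordinates of g are then lifted separately
within the same W. By the max-flow min-cut principle (feasible_flow_of_cut_condition) a scalar demand can
be met as soon as, for every set A, the weighted number of long edges crossing A is at most the W-weighted
number of sign edges crossing A. So all that is needed is an isoperimetric inequality, for indicator
functions f only (long_boundary_le_sgn_boundary).

To prove it, compare f(x) and f(x + m e_j) through the averages of f over the two faces orthogonal to e_j
of the cubes z + {-1,1}^n for z = x, x + 2 e_j, x + 4 e_j, ... The two opposite faces of one cube differ by
twice a level-one Walsh coefficient of f on the cube, and the far face of one cube is the near face of the
next. The averages are truncated by a function constant below 1/4 and above 3/4. Hence a cube on
which f is nearly constant contributes no jump at all, while on any other cube the local sign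
variation U(z) exceeds 1/8, and Bessel's inequality bounds the \<open>\<ell>\<^sub>2\<close> norm of the Walsh
coefficients over the n directions by 1, hence by 8 U(z). This gain over the trivial bound, with
Hoelder's inequality in the direction variable, is what compensates the m/2 jumps along a line. The
capacity W consists of two averages of w, which pay for replacing f by truncated face averages at the two
ends, and of a power mean of averages of w along lines, which pays for the jumps. Neither W as a function of
w nor the choice of the flow is linear, so there is no conflict with the second half.

\<^bold>\<open>Linear liftings.\<close> Testing a linear operator on the sign patterns of all rows of its kernel at
once shows that its regular norm is at least the mean absolute row sum of the kernel. The column of a
lifting belonging to a long edge is a flow of a fixed amount between two points at distance m in the graph
of sign edges, so its mass is at least m times that amount (lifted_edge_mass). Summing over all columns
gives the lower bound \<open>n\<^sup>1\<^sup>/\<^sup>q\<close> (regular_norm_linear_lifting_ge). Routing each long edge along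
zigzag paths of exactly m sign edges, averaged over all starting signs, attains it: the resulting operator
is \<open>n\<^sup>1\<^sup>/\<^sup>q\<close> times an averaging operator, made of translations of the torus and the uniform
average over directions, and averaging does not increase the norm, whatever the values of g.\<close>

section \<open>Feasible flows and the cut condition\<close>

text \<open>The cut condition suffices for a feasible flow. Edges are removed one at a time: the amount \<theta> sent along
the edge e must keep the cut condition valid for the remaining edges, so every set entered by e gives a
lower bound for \<theta> and every set left by e gives an upper bound. A lower bound from A and an upper bound from
B are compatible because the cut capacity is submodular while the demand is modular, and e crosses neither
the intersection nor the union of A and B.\<close>

lemma feasible_flow_of_cut_condition:
  fixes s t :: "'e \<Rightarrow> 'v" and c :: "'e \<Rightarrow> real" and b :: "'v \<Rightarrow> real"
  assumes "finite E" and "finite V"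
    and "\<And>e. e \<in> E \<Longrightarrow> s e \<in> V" and "\<And>e. e \<in> E \<Longrightarrow> t e \<in> V"
    and "\<And>e. e \<in> E \<Longrightarrow> 0 \<le> c e"
    and "sum b V = 0"
    and "\<And>A. A \<subseteq> V \<Longrightarrow> sum b A \<le> (\<Sum>e\<in>E. c e * of_bool ((s e \<in> A) \<noteq> (t e \<in> A)))"
  shows "\<exists>h. (\<forall>e\<in>E. \<bar>h e\<bar> \<le> c e) \<and>
             (\<forall>v\<in>V. (\<Sum>e\<in>E. h e * (of_bool (t e = v) - of_bool (s e = v))) = b v)"
  using assms
proof (induction E arbitrary: b rule: finite_induct)
  case empty
  have "b v = 0" if "v \<in> V" for v
  proof -
    have "b v \<le> 0" using empty(6)[of "{v}"] that by simp
    moreover have "sum b (V - {v}) \<le> 0" using empty(6)[of "V - {v}"] by simp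
    moreover have "sum b V = b v + sum b (V - {v})"
      using sum.remove[OF \<open>finite V\<close> that] .
    ultimately show ?thesis using \<open>sum b V = 0\<close> by simp
  qed
  then show ?case by simp
next
  case (insert e F)
  define C where "C A = (\<Sum>e\<in>F. c e * of_bool ((s e \<in> A) \<noteq> (t e \<in> A)))" for A
  define L where "L = insert (- c e) ((\<lambda>A. sum b A - C A) ` {A. A \<subseteq> V \<and> t e \<in> A \<and> s e \<notin> A})"
  define U where "U = insert (c e) ((\<lambda>A. C A - sum b A) ` {A. A \<subseteq> V \<and> s e \<in> A \<and> t e \<notin> A})"
  have ce: "0 \<le> c e" and cF: "\<And>e. e \<in> F \<Longrightarrow> 0 \<le> c e" using insert.prems(4) by auto
  have cut: "sum b A \<le> c e * of_bool ((s e \<in> A) \<noteq> (t e \<in> A)) + C A" if "A \<subseteq> V" for A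
    using insert.prems(6)[OF that] unfolding C_def sum.insert[OF insert.hyps(1,2)] .
  have submod: "C (A \<inter> B) + C (A \<union> B) \<le> C A + C B" for A B
    unfolding C_def sum.distrib[symmetric] distrib_left[symmetric]
    by (intro sum_mono mult_left_mono cF) auto
  have modular: "sum b (A \<inter> B) + sum b (A \<union> B) = sum b A + sum b B" if "A \<subseteq> V" "B \<subseteq> V" for A B
    using sum.union_inter[of A B b] that \<open>finite V\<close> finite_subset by (metis add.commute)
  have fin: "finite L" "L \<noteq> {}" unfolding L_def using \<open>finite V\<close> by auto
  \<comment> \<open>The bounds for the flow along e are compatible; this is where submodularity enters.\<close>
  have LU: "l \<le> u" if "l \<in> L" "u \<in> U" for l u
  proof -
    have "sum b A - C A \<le> C B - sum b B"
      if "A \<subseteq> V" "t e \<in> A" "s e \<notin> A" "B \<subseteq> V" "s e \<in> B" "t e \<notin> B" for A B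
    proof -
      have "A \<inter> B \<subseteq> V" "A \<union> B \<subseteq> V" using that by auto
      then show ?thesis
        using cut[of "A \<inter> B"] cut[of "A \<union> B"] submod[of A B] modular[of A B] that by simp
    qed
    moreover have "sum b A - C A \<le> c e" if "A \<subseteq> V" "t e \<in> A" "s e \<notin> A" for A
      using cut[of A] that by simp
    moreover have "- c e \<le> C A - sum b A" if "A \<subseteq> V" "s e \<in> A" "t e \<notin> A" for A
      using cut[of A] that by simp
    ultimately show ?thesis
      using that ce unfolding L_def U_def by auto
  qed
  \<comment> \<open>Any value between the lower and the upper bounds will do.\<close>
  define \<theta> where "\<theta> = Max L"
  have lower: "l \<le> \<theta>" if "l \<in> L" for l using fin that unfolding \<theta>_def by simp
  have upper: "\<theta> \<le> u" if "u \<in> U" for u using fin that LU unfolding \<theta>_def by auto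
  have \<theta>: "\<bar>\<theta>\<bar> \<le> c e" using lower[of "- c e"] upper[of "c e"] by (auto simp: L_def U_def)
  define b' where "b' v = b v - \<theta> * (of_bool (t e = v) - of_bool (s e = v))" for v
  have b'_sum: "sum b' A = sum b A - \<theta> * (of_bool (t e \<in> A) - of_bool (s e \<in> A))" if "A \<subseteq> V" for A
  proof -
    have "(\<Sum>v\<in>A. of_bool (u = v)) = (of_bool (u \<in> A) :: real)" for u
      using finite_subset[OF that \<open>finite V\<close>] by (simp add: of_bool_def)
    then show ?thesis
      unfolding b'_def sum_subtractf sum_distrib_left[symmetric] by simp
  qed
  have "\<exists>h. (\<forall>e\<in>F. \<bar>h e\<bar> \<le> c e) \<and>
            (\<forall>v\<in>V. (\<Sum>e\<in>F. h e * (of_bool (t e = v) - of_bool (s e = v))) = b' v)"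
  proof (rule insert.IH)
    show "sum b' V = 0" using b'_sum[of V] insert.prems by simp
    show "sum b' A \<le> (\<Sum>e\<in>F. c e * of_bool ((s e \<in> A) \<noteq> (t e \<in> A)))" if "A \<subseteq> V" for A
    proof -
      have "sum b A - \<theta> * (of_bool (t e \<in> A) - of_bool (s e \<in> A)) \<le> C A"
        using lower[of "sum b A - C A"] upper[of "C A - sum b A"] cut[OF that] that
        by (cases "t e \<in> A"; cases "s e \<in> A") (auto simp: L_def U_def)
      then show ?thesis using b'_sum[OF that] by (simp add: C_def)
    qed
  qed (use insert.prems in auto)
  then obtain h where h: "\<forall>e\<in>F. \<bar>h e\<bar> \<le> c e"
    "\<forall>v\<in>V. (\<Sum>e\<in>F. h e * (of_bool (t e = v) - of_bool (s e = v))) = b' v" by blast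
  have upd: "(\<Sum>e'\<in>F. (h(e := \<theta>)) e' * (of_bool (t e' = v) - of_bool (s e' = v))) =
      (\<Sum>e'\<in>F. h e' * (of_bool (t e' = v) - of_bool (s e' = v)))" for v
    by (intro sum.cong) (use insert.hyps in auto)
  show ?case
    using h \<theta> insert.hyps
    by (intro exI[of _ "h(e := \<theta>)"]) (auto simp: upd b'_def simp del: fun_upd_apply, auto)
qed

section \<open>Power means\<close>

text \<open>The point 0 has to be included, since averages of norms of arbitrary functions are taken below.\<close>

lemma convex_on_powr_nonneg:
  assumes "1 \<le> (\<rho>::real)"
  shows "convex_on {0..} (\<lambda>x. x powr \<rho>)"
proof (rule convex_on_linorderI)
  fix t x y :: real
  assume t: "0 < t" "t < 1" and xy: "x \<in> {0..}" "y \<in> {0..}" "x < y"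
  show "((1 - t) *\<^sub>R x + t *\<^sub>R y) powr \<rho> \<le> (1 - t) * x powr \<rho> + t * y powr \<rho>"
  proof (cases "x = 0")
    case True
    have "t powr \<rho> \<le> t powr 1" using t assms by (intro powr_mono') auto
    then have "(t * y) powr \<rho> \<le> t * y powr \<rho>"
      using t xy by (simp add: powr_mult mult_right_mono)
    then show ?thesis using True assms by simp
  next
    case False
    then show ?thesis
      using convex_onD[OF powr_convex[OF assms], of t x y] t xy by simp
  qed
qed auto

lemma powr_weighted_mean_le:
  fixes y :: "'i \<Rightarrow> real"
  assumes "1 \<le> \<rho>" and "finite I" and "sum w I = 1"
    and "\<And>i. i \<in> I \<Longrightarrow> 0 \<le> w i" and "\<And>i. i \<in> I \<Longrightarrow> 0 \<le> y i"
  shows "(\<Sum>i\<in>I. w i * y i) powr \<rho> \<le> (\<Sum>i\<in>I. w i * y i powr \<rho>)"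
proof -
  have "I \<noteq> {}" using assms(3) by auto
  then show ?thesis
    using convex_on_sum[OF \<open>finite I\<close> _ convex_on_powr_nonneg[OF \<open>1 \<le> \<rho>\<close>], of w y] assms
    by simp
qed

lemma powr_average_le:
  fixes y :: "'i \<Rightarrow> real"
  assumes "1 \<le> \<rho>" and "finite I" and "I \<noteq> {}" and "\<And>i. i \<in> I \<Longrightarrow> 0 \<le> y i"
  shows "((\<Sum>i\<in>I. y i) / real (card I)) powr \<rho> \<le> (\<Sum>i\<in>I. y i powr \<rho>) / real (card I)"
  using powr_weighted_mean_le[of \<rho> I "\<lambda>_. 1 / real (card I)" y] assms
  by (simp add: sum_divide_distrib)

text \<open>Young's inequality applied to both families after normalising them.\<close>

lemma Hoelder_inequality_sum:
  fixes a b :: "'i \<Rightarrow> real"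
  assumes pq: "1 < p" "1 < q" "1 / p + 1 / q = 1" and "finite I"
    and nonneg: "\<And>i. i \<in> I \<Longrightarrow> 0 \<le> a i" "\<And>i. i \<in> I \<Longrightarrow> 0 \<le> b i"
  shows "(\<Sum>i\<in>I. a i * b i) \<le> (\<Sum>i\<in>I. a i powr p) powr (1 / p) * (\<Sum>i\<in>I. b i powr q) powr (1 / q)"
proof -
  define A where "A = (\<Sum>i\<in>I. a i powr p)"
  define B where "B = (\<Sum>i\<in>I. b i powr q)"
  have "A \<ge> 0" "B \<ge> 0" unfolding A_def B_def by (auto intro: sum_nonneg)
  show ?thesis
  proof (cases "A = 0 \<or> B = 0")
    case True
    then have "(\<forall>i\<in>I. a i = 0) \<or> (\<forall>i\<in>I. b i = 0)"
      using \<open>finite I\<close> unfolding A_def B_def by (auto simp: sum_nonneg_eq_0_iff)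
    then have "(\<Sum>i\<in>I. a i * b i) = 0" by (auto intro: sum.neutral)
    then show ?thesis by simp
  next
    case False
    then have "A > 0" "B > 0" using \<open>A \<ge> 0\<close> \<open>B \<ge> 0\<close> by auto
    have "a i / A powr (1 / p) * (b i / B powr (1 / q))
        \<le> a i powr p / A / p + b i powr q / B / q" if "i \<in> I" for i
      using Youngs_inequality[OF pq, of "a i / A powr (1 / p)" "b i / B powr (1 / q)"]
        nonneg[OF that] \<open>A > 0\<close> \<open>B > 0\<close> pq
      by (simp add: powr_divide powr_powr)
    then have "(\<Sum>i\<in>I. a i / A powr (1 / p) * (b i / B powr (1 / q)))
        \<le> (\<Sum>i\<in>I. a i powr p / A / p + b i powr q / B / q)"
      by (rule sum_mono)
    also have "\<dots> = (\<Sum>i\<in>I. a i powr p) / A / p + (\<Sum>i\<in>I. b i powr q) / B / q"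
      by (simp add: sum.distrib sum_divide_distrib)
    also have "\<dots> = 1"
      using \<open>A > 0\<close> \<open>B > 0\<close> pq unfolding A_def B_def by simp
    finally have "(\<Sum>i\<in>I. a i * b i) / (A powr (1 / p) * B powr (1 / q)) \<le> 1"
      by (simp add: sum_divide_distrib)
    then show ?thesis
      using \<open>A > 0\<close> \<open>B > 0\<close> unfolding A_def B_def by (simp add: divide_le_eq)
  qed
qed

text \<open>The norm of L_r on a finite set with normalised counting measure, for nonnegative scalar functions. It
turns the mixed norm into a scalar quantity, applied to the pointwise sup norm.\<close>

definition power_mean :: "ereal \<Rightarrow> 'a set \<Rightarrow> ('a \<Rightarrow> real) \<Rightarrow> real" where
  "power_mean r \<Omega> \<phi> =
     (if r = \<infinity> then Max (\<phi> ` \<Omega>)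
      else ((\<Sum>\<omega>\<in>\<Omega>. \<phi> \<omega> powr real_of_ereal r) / real (card \<Omega>)) powr (1 / real_of_ereal r))"

lemma Lr_norm_eq_power_mean: "Lr_norm r N \<Omega> F = power_mean r \<Omega> (\<lambda>\<omega>. linf_norm N (F \<omega>))"
  unfolding Lr_norm_def power_mean_def by simp

lemma power_mean_ereal_le:
  assumes "0 < \<rho>" and "0 \<le> C"
    and "(\<Sum>\<omega>\<in>\<Omega>'. \<psi> \<omega> powr \<rho>) / real (card \<Omega>')
      \<le> C powr \<rho> * ((\<Sum>\<omega>\<in>\<Omega>. \<phi> \<omega> powr \<rho>) / real (card \<Omega>))"
  shows "power_mean (ereal \<rho>) \<Omega>' \<psi> \<le> C * power_mean (ereal \<rho>) \<Omega> \<phi>"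
proof -
  have "power_mean (ereal \<rho>) \<Omega>' \<psi>
      \<le> (C powr \<rho> * ((\<Sum>\<omega>\<in>\<Omega>. \<phi> \<omega> powr \<rho>) / real (card \<Omega>))) powr (1 / \<rho>)"
    using assms unfolding power_mean_def
    by (auto intro!: powr_mono2 sum_nonneg divide_nonneg_nonneg)
  also have "\<dots> = C * power_mean (ereal \<rho>) \<Omega> \<phi>"
    using assms unfolding power_mean_def
    by (subst powr_mult) (auto simp: powr_powr intro: sum_nonneg)
  finally show ?thesis .
qed

lemma power_mean_infinity_le:
  assumes "finite \<Omega>'" and "\<Omega>' \<noteq> {}" and "finite \<Omega>"
    and "\<And>M \<omega>'. \<omega>' \<in> \<Omega>' \<Longrightarrow> (\<And>\<omega>. \<omega> \<in> \<Omega> \<Longrightarrow> \<phi> \<omega> \<le> M) \<Longrightarrow> \<psi> \<omega>' \<le> C * M"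
  shows "power_mean \<infinity> \<Omega>' \<psi> \<le> C * power_mean \<infinity> \<Omega> \<phi>"
  using assms unfolding power_mean_def by (auto simp: Max_ge)

lemma mean_le_power_mean:
  assumes "1 \<le> r" and "finite \<Omega>" and "\<Omega> \<noteq> {}" and "\<And>\<omega>. \<omega> \<in> \<Omega> \<Longrightarrow> 0 \<le> \<phi> \<omega>"
  shows "(\<Sum>\<omega>\<in>\<Omega>. \<phi> \<omega>) / real (card \<Omega>) \<le> power_mean r \<Omega> \<phi>"
proof (cases r)
  case (real \<rho>)
  then have "1 \<le> \<rho>" using \<open>1 \<le> r\<close> by simp
  have "(\<Sum>\<omega>\<in>\<Omega>. \<phi> \<omega>) / real (card \<Omega>) = (((\<Sum>\<omega>\<in>\<Omega>. \<phi> \<omega>) / real (card \<Omega>)) powr \<rho>) powr (1 / \<rho>)"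
    using \<open>1 \<le> \<rho>\<close> assms by (simp add: powr_powr abs_of_nonneg sum_nonneg)
  also have "\<dots> \<le> ((\<Sum>\<omega>\<in>\<Omega>. \<phi> \<omega> powr \<rho>) / real (card \<Omega>)) powr (1 / \<rho>)"
    using \<open>1 \<le> \<rho>\<close> assms by (intro powr_mono2 powr_average_le) auto
  finally show ?thesis using real by (simp add: power_mean_def)
next
  case PInf
  have "(\<Sum>\<omega>\<in>\<Omega>. \<phi> \<omega>) \<le> real (card \<Omega>) * Max (\<phi> ` \<Omega>)"
    using assms by (intro sum_bounded_above) auto
  then show ?thesis
    using PInf assms by (simp add: power_mean_def divide_le_eq card_gt_0_iff mult.commute)
qed (use \<open>1 \<le> r\<close> in auto)

lemma power_mean_le_one:
  assumes "1 \<le> r" and "finite \<Omega>" and "\<Omega> \<noteq> {}"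
    and \<phi>: "\<And>\<omega>. \<omega> \<in> \<Omega> \<Longrightarrow> 0 \<le> \<phi> \<omega> \<and> \<phi> \<omega> \<le> 1"
  shows "power_mean r \<Omega> \<phi> \<le> 1"
proof (cases r)
  case (real \<rho>)
  then have "1 \<le> \<rho>" using \<open>1 \<le> r\<close> by simp
  have "(\<Sum>\<omega>\<in>\<Omega>. \<phi> \<omega> powr \<rho>) \<le> real (card \<Omega>) * 1"
    using \<phi> \<open>1 \<le> \<rho>\<close> by (intro sum_bounded_above) (auto intro: powr_le1)
  moreover have "0 \<le> (\<Sum>\<omega>\<in>\<Omega>. \<phi> \<omega> powr \<rho>)" by (simp add: sum_nonneg)
  ultimately have "((\<Sum>\<omega>\<in>\<Omega>. \<phi> \<omega> powr \<rho>) / real (card \<Omega>)) powr (1 / \<rho>) \<le> 1"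
    using \<open>finite \<Omega>\<close> \<open>\<Omega> \<noteq> {}\<close> \<open>1 \<le> \<rho>\<close>
    by (intro powr_le1) (simp_all add: divide_le_eq card_gt_0_iff)
  then show ?thesis using real by (simp add: power_mean_def)
next
  case PInf
  then show ?thesis using assms by (simp add: power_mean_def)
qed (use \<open>1 \<le> r\<close> in auto)

lemma abs_le_linf_norm: "1 \<le> i \<Longrightarrow> i \<le> N \<Longrightarrow> \<bar>y i\<bar> \<le> linf_norm N y"
  unfolding linf_norm_def by (intro Max_ge) auto

lemma linf_norm_le: "1 \<le> N \<Longrightarrow> (\<And>i. 1 \<le> i \<Longrightarrow> i \<le> N \<Longrightarrow> \<bar>y i\<bar> \<le> M) \<Longrightarrow> linf_norm N y \<le> M"
  unfolding linf_norm_def by (subst Max_le_iff) auto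

lemma linf_norm_nonneg: "1 \<le> N \<Longrightarrow> 0 \<le> linf_norm N y"
  using abs_le_linf_norm[of 1 N y] by linarith

section \<open>The discrete torus and the sign cube\<close>

locale discrete_torus =
  fixes m n :: nat
  assumes m_pos: "0 < m" and n_pos: "0 < n"
begin

abbreviation "G \<equiv> carrier (torus m n)"

definition translate :: "(nat \<Rightarrow> int) \<Rightarrow> (nat \<Rightarrow> int) \<Rightarrow> nat \<Rightarrow> int" (infixl \<open>\<boxplus>\<close> 65) where
  "x \<boxplus> v = (\<lambda>i\<in>{1..n}. (x i + v i) mod (2 * int m))"

text \<open>The vector a e_j; long edges are translations by the vector with a = m.\<close>

definition axis :: "nat \<Rightarrow> int \<Rightarrow> nat \<Rightarrow> int" where
  "axis j a = (\<lambda>i. a * std_basis j i)"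

lemma axis_apply: "axis j a i = (if i = j then a else 0)"
  by (simp add: axis_def std_basis_def)

lemma torus_carrier: "G = ({1..n} \<rightarrow>\<^sub>E {0..<2 * int m})"
  using m_pos by (auto simp: torus_def carrier_integer_mod_group)

lemma finite_torus: "finite G"
  unfolding torus_carrier by (intro finite_PiE) auto

lemma torus_nonempty: "G \<noteq> {}"
  unfolding torus_carrier PiE_eq_empty_iff using m_pos by auto

lemma torus_sub_eq_translate:
  assumes "x \<in> G"
  shows "torus_sub m n x v = x \<boxplus> (\<lambda>i. - v i)"
proof -
  have v: "torus_of m n v \<in> ({1..n} \<rightarrow>\<^sub>E carrier (integer_mod_group (2 * m)))"
    using m_pos by (auto simp: torus_of_def carrier_integer_mod_group)
  have "inv\<^bsub>torus m n\<^esub> torus_of m n v =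
      (\<lambda>i\<in>{1..n}. inv\<^bsub>integer_mod_group (2 * m)\<^esub> (torus_of m n v i))"
    unfolding torus_def by (rule inv_product_group[OF v]) simp
  also have "\<dots> = (\<lambda>i\<in>{1..n}. (- v i) mod (2 * int m))"
    using v by (intro restrict_ext) (auto simp: torus_of_def mod_minus_eq PiE_iff)
  finally show ?thesis
    unfolding torus_sub_def translate_def torus_def
    by (auto simp: mod_add_right_eq intro!: restrict_ext)
qed

lemma translate_in_torus [simp]: "x \<boxplus> v \<in> G"
  unfolding torus_carrier translate_def using m_pos by auto

lemma translate_translate: "x \<boxplus> u \<boxplus> v = x \<boxplus> (\<lambda>i. u i + v i)"
  unfolding translate_def by (auto intro!: restrict_ext simp: mod_simps algebra_simps)

lemma translate_cong:
  assumes "\<And>i. i \<in> {1..n} \<Longrightarrow> u i mod (2 * int m) = v i mod (2 * int m)"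
  shows "x \<boxplus> u = x \<boxplus> v"
  unfolding translate_def by (intro restrict_ext) (metis assms mod_add_right_eq)

lemma translate_zero: "x \<in> G \<Longrightarrow> x \<boxplus> (\<lambda>_. 0) = x"
  unfolding translate_def torus_carrier by (auto simp: PiE_iff extensional_def)

lemma translate_axis_half_turn: "x \<boxplus> axis j (- int m) = x \<boxplus> axis j (int m)"
proof (rule translate_cong)
  have "(- int m) mod (2 * int m) = int m mod (2 * int m)"
    using mod_add_self2[of "- int m" "2 * int m"] by (simp add: algebra_simps)
  then show "axis j (- int m) i mod (2 * int m) = axis j (int m) i mod (2 * int m)" for i
    by (simp add: axis_apply)
qed

lemma bij_translate: "bij_betw (\<lambda>x. x \<boxplus> v) G G"
  by (rule bij_betw_byWitness[where f' = "\<lambda>x. x \<boxplus> (\<lambda>i. - v i)"])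
     (auto simp: translate_translate translate_zero)

lemma sum_translate: "(\<Sum>x\<in>G. f (x \<boxplus> v)) = (\<Sum>x\<in>G. f x)"
  using sum.reindex_bij_betw[OF bij_translate] .

text \<open>Summation by parts on the torus: translation by -v is the adjoint of translation by v.\<close>

lemma sum_translate_pairing:
  "(\<Sum>x\<in>G. u x * h (x \<boxplus> (\<lambda>i. - v i))) = (\<Sum>x\<in>G. u (x \<boxplus> v) * h x)" for u h :: "_ \<Rightarrow> real"
proof -
  have "(\<Sum>x\<in>G. u (x \<boxplus> v) * h x) = (\<Sum>x\<in>G. u (x \<boxplus> v) * h (x \<boxplus> v \<boxplus> (\<lambda>i. - v i)))"
    by (intro sum.cong) (simp_all add: translate_translate translate_zero)
  then show ?thesis
    using sum_translate[of "\<lambda>x. u x * h (x \<boxplus> (\<lambda>i. - v i))" v] by simp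
qed

lemma finite_signs [simp]: "finite (signs n)"
  unfolding signs_def by (intro finite_PiE) auto

lemma card_signs [simp]: "card (signs n) = 2 ^ n"
  unfolding signs_def by (simp add: card_PiE numeral_2_eq_2)

lemma signs_nonempty [simp]: "signs n \<noteq> {}"
  unfolding signs_def PiE_eq_empty_iff by auto

lemma sign_cases: "\<epsilon> \<in> signs n \<Longrightarrow> j \<in> {1..n} \<Longrightarrow> \<epsilon> j = 1 \<or> \<epsilon> j = -1"
  unfolding signs_def by (auto simp: PiE_iff)

text \<open>Two consecutive steps \<epsilon> and reflect j \<epsilon> move every coordinate other than j back and forth, and
together they make the step 2 \<epsilon>_j e_j.\<close>

definition reflect :: "nat \<Rightarrow> (nat \<Rightarrow> int) \<Rightarrow> nat \<Rightarrow> int" where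
  "reflect j \<epsilon> = (\<lambda>i\<in>{1..n}. if i = j then \<epsilon> i else - \<epsilon> i)"

lemma flip_in_signs: "\<epsilon> \<in> signs n \<Longrightarrow> j \<in> {1..n} \<Longrightarrow> \<epsilon>(j := - \<epsilon> j) \<in> signs n"
  using sign_cases[of \<epsilon> j] unfolding signs_def
  by (auto simp: PiE_iff extensional_def)

lemma bij_flip: "j \<in> {1..n} \<Longrightarrow> bij_betw (\<lambda>\<epsilon>. \<epsilon>(j := - \<epsilon> j)) (signs n) (signs n)"
  by (rule bij_betw_byWitness[where f' = "\<lambda>\<epsilon>. \<epsilon>(j := - \<epsilon> j)"])
     (auto intro!: flip_in_signs simp del: fun_upd_apply, auto)

lemma sum_flip:
  "j \<in> {1..n} \<Longrightarrow> (\<Sum>\<epsilon>\<in>signs n. f (\<epsilon>(j := - \<epsilon> j))) = (\<Sum>\<epsilon>\<in>signs n. f \<epsilon>)"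
  using sum.reindex_bij_betw[OF bij_flip] .

lemma reflect_in_signs: "\<epsilon> \<in> signs n \<Longrightarrow> reflect j \<epsilon> \<in> signs n"
  unfolding signs_def reflect_def by (auto simp: PiE_iff)

lemma reflect_reflect: "\<epsilon> \<in> signs n \<Longrightarrow> reflect j (reflect j \<epsilon>) = \<epsilon>"
  unfolding signs_def reflect_def by (auto simp: PiE_iff extensional_def)

lemma sum_reflect: "(\<Sum>\<epsilon>\<in>signs n. f (reflect j \<epsilon>)) = (\<Sum>\<epsilon>\<in>signs n. f \<epsilon>)"
  by (rule sum.reindex_bij_betw, rule bij_betw_byWitness[where f' = "reflect j"])
     (auto simp: reflect_in_signs reflect_reflect)

lemma sum_signs_orthogonal:
  assumes "i \<in> {1..n}" "j \<in> {1..n}"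
  shows "(\<Sum>\<epsilon>\<in>signs n. real_of_int (\<epsilon> i) * real_of_int (\<epsilon> j)) = (if i = j then 2 ^ n else 0)"
proof (cases "i = j")
  case True
  have "(\<Sum>\<epsilon>\<in>signs n. real_of_int (\<epsilon> i) * real_of_int (\<epsilon> j)) = (\<Sum>\<epsilon>\<in>signs n. 1)"
    using sign_cases[OF _ assms(1)] True by (intro sum.cong) force+
  then show ?thesis using True by simp
next
  case False
  then show ?thesis
    using sum_flip[OF assms(1), of "\<lambda>\<epsilon>. real_of_int (\<epsilon> i) * real_of_int (\<epsilon> j)"]
    by (simp add: sum_negf)
qed

definition sgn_mean :: "((nat \<Rightarrow> int) \<Rightarrow> real) \<Rightarrow> real" where
  "sgn_mean f = (\<Sum>\<epsilon>\<in>signs n. f \<epsilon>) / 2 ^ n"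

lemma sgn_mean_add: "sgn_mean (\<lambda>\<epsilon>. f \<epsilon> + g \<epsilon>) = sgn_mean f + sgn_mean g"
  by (simp add: sgn_mean_def sum.distrib add_divide_distrib)

lemma sgn_mean_diff: "sgn_mean (\<lambda>\<epsilon>. f \<epsilon> - g \<epsilon>) = sgn_mean f - sgn_mean g"
  by (simp add: sgn_mean_def sum_subtractf diff_divide_distrib)

lemma sgn_mean_cmult: "sgn_mean (\<lambda>\<epsilon>. c * f \<epsilon>) = c * sgn_mean f"
  by (simp add: sgn_mean_def sum_distrib_left)

lemma sgn_mean_const: "sgn_mean (\<lambda>_. c) = c"
  by (simp add: sgn_mean_def)

lemma sgn_mean_mono: "(\<And>\<epsilon>. \<epsilon> \<in> signs n \<Longrightarrow> f \<epsilon> \<le> g \<epsilon>) \<Longrightarrow> sgn_mean f \<le> sgn_mean g"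
  unfolding sgn_mean_def by (intro divide_right_mono sum_mono) auto

lemma sgn_mean_sum: "sgn_mean (\<lambda>\<epsilon>. \<Sum>i\<in>I. f i \<epsilon>) = (\<Sum>i\<in>I. sgn_mean (f i))"
  unfolding sgn_mean_def by (subst sum.swap) (simp add: sum_divide_distrib)

text \<open>The coordinate functions are orthonormal on the sign cube.\<close>

lemma Bessel_level_one:
  "(\<Sum>j\<in>{1..n}. (sgn_mean (\<lambda>\<epsilon>. real_of_int (\<epsilon> j) * f \<epsilon>))\<^sup>2) \<le> sgn_mean (\<lambda>\<epsilon>. (f \<epsilon>)\<^sup>2)"
proof -
  define c where "c j = sgn_mean (\<lambda>\<epsilon>. real_of_int (\<epsilon> j) * f \<epsilon>)" for j
  \<comment> \<open>The projection of f onto the span of the coordinate functions.\<close>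
  define s where "s \<epsilon> = (\<Sum>j\<in>{1..n}. c j * real_of_int (\<epsilon> j))" for \<epsilon>
  have cross: "sgn_mean (\<lambda>\<epsilon>. f \<epsilon> * s \<epsilon>) = (\<Sum>j\<in>{1..n}. (c j)\<^sup>2)"
  proof -
    have "sgn_mean (\<lambda>\<epsilon>. f \<epsilon> * s \<epsilon>) = sgn_mean (\<lambda>\<epsilon>. \<Sum>j\<in>{1..n}. c j * (real_of_int (\<epsilon> j) * f \<epsilon>))"
      by (simp add: s_def sum_distrib_left mult_ac)
    also have "\<dots> = (\<Sum>j\<in>{1..n}. (c j)\<^sup>2)"
      by (simp add: sgn_mean_sum sgn_mean_cmult c_def power2_eq_square)
    finally show ?thesis .
  qed
  have square: "sgn_mean (\<lambda>\<epsilon>. (s \<epsilon>)\<^sup>2) = (\<Sum>j\<in>{1..n}. (c j)\<^sup>2)"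
  proof -
    have "sgn_mean (\<lambda>\<epsilon>. (s \<epsilon>)\<^sup>2) =
        sgn_mean (\<lambda>\<epsilon>. \<Sum>i\<in>{1..n}. \<Sum>j\<in>{1..n}. c i * c j * (real_of_int (\<epsilon> i) * real_of_int (\<epsilon> j)))"
      by (simp add: s_def power2_eq_square sum_product mult_ac)
    also have "\<dots> = (\<Sum>i\<in>{1..n}. \<Sum>j\<in>{1..n}. c i * c j * (if i = j then 1 else 0))"
      unfolding sgn_mean_sum sgn_mean_cmult
      by (intro sum.cong refl) (auto simp: sgn_mean_def sum_signs_orthogonal)
    also have "\<dots> = (\<Sum>j\<in>{1..n}. (c j)\<^sup>2)"
      by (simp add: power2_eq_square if_distrib sum.delta' cong: if_cong)
    finally show ?thesis .
  qed
  have "0 \<le> sgn_mean (\<lambda>\<epsilon>. (f \<epsilon> - s \<epsilon>)\<^sup>2)"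
    using sgn_mean_mono[of "\<lambda>_. 0"] by (simp add: sgn_mean_const)
  also have "\<dots> = sgn_mean (\<lambda>\<epsilon>. (f \<epsilon>)\<^sup>2) - 2 * sgn_mean (\<lambda>\<epsilon>. f \<epsilon> * s \<epsilon>) + sgn_mean (\<lambda>\<epsilon>. (s \<epsilon>)\<^sup>2)"
    unfolding sgn_mean_cmult[symmetric] sgn_mean_diff[symmetric] sgn_mean_add[symmetric]
    by (simp add: power2_diff algebra_simps)
  finally show ?thesis unfolding cross square c_def by simp
qed

end

section \<open>A weighted isoperimetric inequality on the torus\<close>

text \<open>The piecewise linear function that vanishes up to 1/4 and equals 1 from 3/4 on. It fixes 0 and 1, so on
indicator functions it costs nothing, and it kills the fluctuation of averages close to 0 or 1.\<close>

definition clip :: "real \<Rightarrow> real" where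
  "clip b = max 0 (min 1 (2 * b - 1 / 2))"

context discrete_torus
begin

text \<open>For \<sigma> = 1 and \<sigma> = -1 this is the average of f over the points x + \<epsilon> with \<epsilon>_j = \<sigma>, that
is over a face of the cube around x.\<close>

definition face_mean :: "((nat \<Rightarrow> int) \<Rightarrow> real) \<Rightarrow> nat \<Rightarrow> real \<Rightarrow> (nat \<Rightarrow> int) \<Rightarrow> real" where
  "face_mean f j \<sigma> x = sgn_mean (\<lambda>\<epsilon>. (1 + \<sigma> * real_of_int (\<epsilon> j)) * f (x \<boxplus> \<epsilon>))"

definition sgn_variation :: "((nat \<Rightarrow> int) \<Rightarrow> real) \<Rightarrow> (nat \<Rightarrow> int) \<Rightarrow> real" where
  "sgn_variation f x = sgn_mean (\<lambda>\<epsilon>. \<bar>f (x \<boxplus> \<epsilon>) - f x\<bar>)"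

definition clip_jump :: "((nat \<Rightarrow> int) \<Rightarrow> real) \<Rightarrow> nat \<Rightarrow> (nat \<Rightarrow> int) \<Rightarrow> real" where
  "clip_jump f j x = \<bar>clip (face_mean f j 1 x) - clip (face_mean f j (-1) x)\<bar>"

lemma sgn_variation_nonneg: "0 \<le> sgn_variation f x"
  using sgn_mean_mono[of "\<lambda>_. 0"] by (simp add: sgn_mean_const sgn_variation_def)

text \<open>The upper face in direction j of the cube around x is the lower face of the cube around x + 2 e_j.\<close>

lemma face_mean_step:
  assumes j: "j \<in> {1..n}"
  shows "face_mean f j 1 x = face_mean f j (-1) (x \<boxplus> axis j 2)"
proof -
  have "(1 + real_of_int (\<epsilon> j)) * f (x \<boxplus> \<epsilon>) =
      (1 + real_of_int (\<epsilon> j)) * f (x \<boxplus> axis j 2 \<boxplus> \<epsilon>(j := - \<epsilon> j))" if "\<epsilon> \<in> signs n" for \<epsilon>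
  proof (cases "\<epsilon> j = 1")
    case True
    have "(\<lambda>i. axis j 2 i + (\<epsilon>(j := - \<epsilon> j)) i) = \<epsilon>"
      using True by (auto simp: axis_apply)
    then show ?thesis by (simp add: translate_translate)
  next
    case False
    then show ?thesis using sign_cases[OF that j] by simp
  qed
  then have "(\<Sum>\<epsilon>\<in>signs n. (1 + real_of_int (\<epsilon> j)) * f (x \<boxplus> \<epsilon>)) =
      (\<Sum>\<epsilon>\<in>signs n. (1 + real_of_int (\<epsilon> j)) * f (x \<boxplus> axis j 2 \<boxplus> \<epsilon>(j := - \<epsilon> j)))"
    by (rule sum.cong[OF refl])
  also have "\<dots> = (\<Sum>\<epsilon>\<in>signs n. (1 - real_of_int (\<epsilon> j)) * f (x \<boxplus> axis j 2 \<boxplus> \<epsilon>))"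
    using sum_flip[OF j, of "\<lambda>\<epsilon>. (1 - real_of_int (\<epsilon> j)) * f (x \<boxplus> axis j 2 \<boxplus> \<epsilon>)"] by simp
  finally show ?thesis by (simp add: face_mean_def sgn_mean_def)
qed

lemma sgn_mean_coordinate: "j \<in> {1..n} \<Longrightarrow> sgn_mean (\<lambda>\<epsilon>. real_of_int (\<epsilon> j)) = 0"
  using sum_flip[of j "\<lambda>\<epsilon>. real_of_int (\<epsilon> j)"] by (simp add: sgn_mean_def sum_negf)

lemma face_mean_eq:
  "face_mean f j \<sigma> x =
     sgn_mean (\<lambda>\<epsilon>. f (x \<boxplus> \<epsilon>)) + \<sigma> * sgn_mean (\<lambda>\<epsilon>. real_of_int (\<epsilon> j) * f (x \<boxplus> \<epsilon>))"
  unfolding face_mean_def sgn_mean_cmult[symmetric] sgn_mean_add[symmetric]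
  by (simp add: algebra_simps)

lemma face_mean_bounds:
  assumes f: "\<And>x. x \<in> G \<Longrightarrow> f x \<in> {0..1}" and j: "j \<in> {1..n}" and \<sigma>: "\<sigma> \<in> {-1, 1}"
  shows "0 \<le> face_mean f j \<sigma> x" and "face_mean f j \<sigma> x \<le> 1"
proof -
  have w: "0 \<le> 1 + \<sigma> * real_of_int (\<epsilon> j)" if "\<epsilon> \<in> signs n" for \<epsilon>
    using sign_cases[OF that j] \<sigma> by auto
  show "0 \<le> face_mean f j \<sigma> x"
    using sgn_mean_mono[of "\<lambda>_. 0"] f w unfolding face_mean_def
    by (simp add: sgn_mean_const)
  have "face_mean f j \<sigma> x \<le> sgn_mean (\<lambda>\<epsilon>. 1 + \<sigma> * real_of_int (\<epsilon> j))"
    unfolding face_mean_def by (rule sgn_mean_mono) (use f w in \<open>auto intro: mult_left_le\<close>)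
  also have "\<dots> = 1"
    by (simp add: sgn_mean_add sgn_mean_cmult sgn_mean_const sgn_mean_coordinate[OF j])
  finally show "face_mean f j \<sigma> x \<le> 1" .
qed

lemma sgn_variation_eq:
  assumes f: "\<And>x. x \<in> G \<Longrightarrow> f x \<in> {0, 1}" and x: "x \<in> G"
  shows "sgn_variation f x =
    (if f x = 0 then sgn_mean (\<lambda>\<epsilon>. f (x \<boxplus> \<epsilon>)) else 1 - sgn_mean (\<lambda>\<epsilon>. f (x \<boxplus> \<epsilon>)))"
proof -
  have *: "f (x \<boxplus> \<epsilon>) = 0 \<or> f (x \<boxplus> \<epsilon>) = 1" for \<epsilon> using f[of "x \<boxplus> \<epsilon>"] by simp
  show ?thesis
  proof (cases "f x = 0")
    case True
    have "\<bar>f (x \<boxplus> \<epsilon>) - f x\<bar> = f (x \<boxplus> \<epsilon>)" for \<epsilon> using *[of \<epsilon>] True by auto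
    then show ?thesis using True by (simp add: sgn_variation_def)
  next
    case False
    then have "f x = 1" using f[OF x] by simp
    then have "\<bar>f (x \<boxplus> \<epsilon>) - f x\<bar> = 1 - f (x \<boxplus> \<epsilon>)" for \<epsilon> using *[of \<epsilon>] by auto
    then show ?thesis using False by (simp add: sgn_variation_def sgn_mean_diff sgn_mean_const)
  qed
qed

text \<open>If f(x) = 0, the sign variation at x is the mean of f over the cube, and a face average is at most twice
that mean; the truncation is at most 4/3 of its argument. The case f(x) = 1 is symmetric.\<close>

lemma clip_face_mean_close:
  assumes f: "\<And>x. x \<in> G \<Longrightarrow> f x \<in> {0, 1}" and j: "j \<in> {1..n}" and x: "x \<in> G"
  shows "\<bar>f x - clip (face_mean f j (-1) x)\<bar> \<le> 3 * sgn_variation f x"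
proof -
  have f': "\<And>x. x \<in> G \<Longrightarrow> f x \<in> {0..1}" using f by fastforce
  have "face_mean f j 1 x + face_mean f j (-1) x = 2 * sgn_mean (\<lambda>\<epsilon>. f (x \<boxplus> \<epsilon>))"
    by (simp add: face_mean_eq)
  then show ?thesis
    using face_mean_bounds[where f = f, OF f' j, where \<sigma> = 1 and x = x] face_mean_bounds[where f = f, OF f' j, where \<sigma> = "-1" and x = x]
      sgn_variation_eq[where f = f, OF f x] f[OF x]
    by (auto simp: clip_def abs_if max_def min_def)
qed

text \<open>The face averages differ by twice the Walsh coefficient, and the truncation has slope at most 2.\<close>

lemma clip_jump_le_coefficient:
  "clip_jump f j x \<le> 4 * \<bar>sgn_mean (\<lambda>\<epsilon>. real_of_int (\<epsilon> j) * f (x \<boxplus> \<epsilon>))\<bar>"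
  unfolding clip_jump_def face_mean_eq clip_def by (auto simp: abs_if max_def min_def)

lemma clip_jump_bounds: "0 \<le> clip_jump f j x" "clip_jump f j x \<le> 1"
  unfolding clip_jump_def clip_def by auto

text \<open>If f is nearly constant on the cube, both face averages lie in the same region where the truncation is
constant.\<close>

lemma clip_jump_eq_0:
  assumes f: "\<And>x. x \<in> G \<Longrightarrow> f x \<in> {0, 1}" and j: "j \<in> {1..n}" and x: "x \<in> G"
    and small: "sgn_variation f x \<le> 1 / 8"
  shows "clip_jump f j x = 0"
proof -
  have f': "\<And>x. x \<in> G \<Longrightarrow> f x \<in> {0..1}" using f by fastforce
  have "face_mean f j 1 x + face_mean f j (-1) x = 2 * sgn_mean (\<lambda>\<epsilon>. f (x \<boxplus> \<epsilon>))"
    by (simp add: face_mean_eq)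
  then show ?thesis
    using face_mean_bounds[where f = f, OF f' j, where \<sigma> = 1 and x = x] face_mean_bounds[where f = f, OF f' j, where \<sigma> = "-1" and x = x]
      sgn_variation_eq[where f = f, OF f x] small
    by (auto simp: clip_jump_def clip_def split: if_splits)
qed

text \<open>Either all jumps vanish, or the sign variation exceeds 1/8 and the right-hand side exceeds 4 to the
power q, which bounds the left-hand side by Bessel's inequality, as q \<ge> 2.\<close>

lemma sum_clip_jump_powr_le:
  assumes f: "\<And>x. x \<in> G \<Longrightarrow> f x \<in> {0, 1}" and x: "x \<in> G" and q: "2 \<le> q"
  shows "(\<Sum>j\<in>{1..n}. clip_jump f j x powr q) \<le> (32 * sgn_variation f x) powr q"
proof (cases "sgn_variation f x \<le> 1 / 8")
  case True
  then have "(\<Sum>j\<in>{1..n}. clip_jump f j x powr q) = 0"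
    using clip_jump_eq_0[where f = f, OF f _ x] by (intro sum.neutral) auto
  then show ?thesis by simp
next
  case False
  define c where "c j = sgn_mean (\<lambda>\<epsilon>. real_of_int (\<epsilon> j) * f (x \<boxplus> \<epsilon>))" for j
  have "clip_jump f j x powr q \<le> 4 powr q * (c j)\<^sup>2" for j
  proof -
    \<comment> \<open>Dividing by 4 gives a number in the unit interval, so that raising the exponent from 2 to q decreases it.\<close>
    have "(clip_jump f j x / 4) powr q \<le> (clip_jump f j x / 4) powr 2"
      using clip_jump_bounds[of f j x] q by (intro powr_mono') auto
    also have "\<dots> = (clip_jump f j x / 4)\<^sup>2"
      using clip_jump_bounds(1)[of f j x] by (cases "clip_jump f j x = 0") (auto simp: powr_numeral)
    also have "\<dots> \<le> \<bar>c j\<bar>\<^sup>2"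
      using clip_jump_le_coefficient[of f j x] clip_jump_bounds(1)[of f j x] unfolding c_def
      by (intro power_mono) auto
    finally show ?thesis
      using clip_jump_bounds(1)[of f j x] by (simp add: powr_divide divide_le_eq mult.commute)
  qed
  then have "(\<Sum>j\<in>{1..n}. clip_jump f j x powr q) \<le> 4 powr q * (\<Sum>j\<in>{1..n}. (c j)\<^sup>2)"
    unfolding sum_distrib_left by (intro sum_mono) auto
  also have "\<dots> \<le> 4 powr q * 1"
  proof (rule mult_left_mono)
    have "(\<Sum>j\<in>{1..n}. (c j)\<^sup>2) \<le> sgn_mean (\<lambda>\<epsilon>. (f (x \<boxplus> \<epsilon>))\<^sup>2)"
      unfolding c_def by (rule Bessel_level_one)
    also have "\<dots> \<le> sgn_mean (\<lambda>_. 1)"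
    proof (rule sgn_mean_mono)
      show "(f (x \<boxplus> \<epsilon>))\<^sup>2 \<le> 1" for \<epsilon> using f[of "x \<boxplus> \<epsilon>"] by auto
    qed
    finally show "(\<Sum>j\<in>{1..n}. (c j)\<^sup>2) \<le> 1" by (simp add: sgn_mean_const)
  qed auto
  also have "\<dots> \<le> (32 * sgn_variation f x) powr q"
    using False q by (simp add: powr_mono2)
  finally show ?thesis .
qed

text \<open>Along the line through x in direction j, consecutive cubes share a face, so the truncated face averages
change only by the jumps inside the cubes.\<close>

lemma clip_face_mean_telescope:
  assumes j: "j \<in> {1..n}" and x: "x \<in> G"
  shows "\<bar>clip (face_mean f j (-1) (x \<boxplus> axis j (2 * int K))) - clip (face_mean f j (-1) x)\<bar>
    \<le> (\<Sum>k<K. clip_jump f j (x \<boxplus> axis j (2 * int k)))"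
proof (induction K)
  case 0
  have "axis j 0 = (\<lambda>_. 0)" by (auto simp: axis_apply)
  then show ?case using x by (simp add: translate_zero)
next
  case (Suc K)
  have "(\<lambda>i. axis j (2 * int K) i + axis j 2 i) = axis j (2 * int (Suc K))"
    by (auto simp: axis_apply)
  then have "face_mean f j (-1) (x \<boxplus> axis j (2 * int (Suc K)))
      = face_mean f j 1 (x \<boxplus> axis j (2 * int K))"
    using face_mean_step[OF j, of f "x \<boxplus> axis j (2 * int K)"] by (simp add: translate_translate)
  then show ?case
    using Suc by (simp add: clip_jump_def)
qed

lemma long_difference_le:
  assumes f: "\<And>x. x \<in> G \<Longrightarrow> f x \<in> {0, 1}" and j: "j \<in> {1..n}" and x: "x \<in> G" and "even m"
  shows "\<bar>f (x \<boxplus> axis j (int m)) - f x\<bar> \<le>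
    3 * sgn_variation f x + 3 * sgn_variation f (x \<boxplus> axis j (int m))
    + (\<Sum>k<m div 2. clip_jump f j (x \<boxplus> axis j (2 * int k)))"
proof -
  have "2 * int (m div 2) = int m" using \<open>even m\<close> by presburger
  then show ?thesis
    using clip_face_mean_telescope[OF j x, of f "m div 2"] clip_face_mean_close[where f = f, OF f j x]
      clip_face_mean_close[where f = f, OF f j, where x = "x \<boxplus> axis j (int m)"] by simp
qed

text \<open>Subtracting a e_j sends the end point of an edge in direction j back to where it came from: with a = 0 and
a = m these are the averages of w over the long edges that start, respectively end, at x.\<close>

definition axis_average :: "((nat \<Rightarrow> int) \<times> nat \<Rightarrow> real) \<Rightarrow> int \<Rightarrow> (nat \<Rightarrow> int) \<Rightarrow> real" where
  "axis_average w a x = (\<Sum>j\<in>{1..n}. w (x \<boxplus> axis j (- a), j)) / real n"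

text \<open>The average of w over those edges in direction j whose line of cubes passes through the cube around x.\<close>

definition line_average :: "((nat \<Rightarrow> int) \<times> nat \<Rightarrow> real) \<Rightarrow> nat \<Rightarrow> (nat \<Rightarrow> int) \<Rightarrow> real" where
  "line_average w j x = (\<Sum>k<m div 2. w (x \<boxplus> axis j (- (2 * int k)), j)) / real (m div 2)"

definition line_power_mean :: "real \<Rightarrow> ((nat \<Rightarrow> int) \<times> nat \<Rightarrow> real) \<Rightarrow> (nat \<Rightarrow> int) \<Rightarrow> real" where
  "line_power_mean s w x = ((\<Sum>j\<in>{1..n}. line_average w j x powr s) / real n) powr (1 / s)"

text \<open>The first two terms pay for the two ends of a long edge, the third for the jumps in between. It depends on
the point only, so all sign edges leaving x have the same capacity. The coefficients add up to 22.\<close>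

definition capacity :: "real \<Rightarrow> ((nat \<Rightarrow> int) \<times> nat \<Rightarrow> real) \<Rightarrow> (nat \<Rightarrow> int) \<Rightarrow> real" where
  "capacity s w x =
     3 * axis_average w 0 x + 3 * axis_average w (int m) x + 16 * line_power_mean s w x"

lemma sum_translate_axis:
  "(\<Sum>x\<in>G. g x * h (x \<boxplus> axis j a)) = (\<Sum>x\<in>G. g (x \<boxplus> axis j (- a)) * h x)" for g h :: "_ \<Rightarrow> real"
proof -
  have "(\<lambda>i. - axis j (- a) i) = axis j a" by (auto simp: axis_apply)
  then show ?thesis using sum_translate_pairing[of g h "axis j (- a)"] by simp
qed

text \<open>Each difference along a long edge is split into its two ends and the jumps in between, and summation by
parts moves the weights to the cubes in which variation occurs. There Hoelder's inequality over the n
directions, with exponents s and q, meets the bound on the jumps. The powers of n produced by Hoelder's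
inequality and by normalisation cancel because 1/s + 1/q = 1. The assumption n \<le> m^q keeps the
contribution of the ends bounded.\<close>

lemma long_boundary_le_sgn_boundary:
  assumes f: "\<And>x. x \<in> G \<Longrightarrow> f x \<in> {0, 1}" and w: "\<And>\<omega>. 0 \<le> w \<omega>"
    and q: "2 \<le> q" and s: "s = q / (q - 1)" and "even m" and nm: "real n \<le> real m powr q"
  shows "real n powr (1 / q) / real m *
      ((\<Sum>x\<in>G. \<Sum>j\<in>{1..n}. w (x, j) * \<bar>f (x \<boxplus> axis j (int m)) - f x\<bar>) / real n)
    \<le> (\<Sum>x\<in>G. capacity s w x * sgn_variation f x)"
proof -
  define c where "c = real n powr (1 / q) / real m"
  define U where "U = sgn_variation f"
  have U: "0 \<le> U x" for x unfolding U_def by (rule sgn_variation_nonneg)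
  have s1: "1 < s" "1 / s + 1 / q = 1" using q unfolding s by (auto simp: field_simps)
  have "0 \<le> c" unfolding c_def by simp
  have "c \<le> 1"
  proof -
    have "real n powr (1 / q) \<le> (real m powr q) powr (1 / q)"
      using nm q by (intro powr_mono2) auto
    also have "\<dots> = real m" using q by (simp add: powr_powr)
    finally show ?thesis using m_pos unfolding c_def by simp
  qed
  have split: "(\<Sum>x\<in>G. \<Sum>j\<in>{1..n}. w (x, j) * \<bar>f (x \<boxplus> axis j (int m)) - f x\<bar>) \<le>
      (\<Sum>x\<in>G. \<Sum>j\<in>{1..n}. w (x, j) * (3 * U x)) +
      (\<Sum>x\<in>G. \<Sum>j\<in>{1..n}. w (x, j) * (3 * U (x \<boxplus> axis j (int m)))) +
      (\<Sum>x\<in>G. \<Sum>j\<in>{1..n}. \<Sum>k<m div 2. w (x, j) * clip_jump f j (x \<boxplus> axis j (2 * int k)))"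
    unfolding sum.distrib[symmetric] sum_distrib_left[symmetric] distrib_left[symmetric]
    using long_difference_le[where f = f, OF f _ _ \<open>even m\<close>] w unfolding U_def
    by (intro sum_mono mult_left_mono) (auto simp: sum_distrib_left)
  have start: "(\<Sum>x\<in>G. \<Sum>j\<in>{1..n}. w (x, j) * (3 * U x)) = real n * (\<Sum>x\<in>G. 3 * axis_average w 0 x * U x)"
  proof -
    have z: "axis j 0 = (\<lambda>_. 0)" for j by (auto simp: axis_apply)
    have "(\<Sum>j\<in>{1..n}. w (x, j) * (3 * U x)) = real n * (3 * axis_average w 0 x * U x)" if "x \<in> G" for x
      using that n_pos by (simp add: axis_average_def z translate_zero flip: sum_distrib_right)
    then show ?thesis unfolding sum_distrib_left by (rule sum.cong[OF refl])
  qed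
  have target: "(\<Sum>x\<in>G. \<Sum>j\<in>{1..n}. w (x, j) * (3 * U (x \<boxplus> axis j (int m))))
      = real n * (\<Sum>x\<in>G. 3 * axis_average w (int m) x * U x)"
  proof -
    have "(\<Sum>x\<in>G. \<Sum>j\<in>{1..n}. w (x, j) * (3 * U (x \<boxplus> axis j (int m)))) =
        (\<Sum>j\<in>{1..n}. \<Sum>x\<in>G. w (x, j) * (3 * U (x \<boxplus> axis j (int m))))"
      by (rule sum.swap)
    also have "\<dots> = (\<Sum>j\<in>{1..n}. \<Sum>x\<in>G. w (x \<boxplus> axis j (- int m), j) * (3 * U x))"
      using sum_translate_axis[of "\<lambda>x. w (x, j)" "\<lambda>x. 3 * U x" j "int m" for j] by simp
    also have "\<dots> = (\<Sum>x\<in>G. \<Sum>j\<in>{1..n}. w (x \<boxplus> axis j (- int m), j) * (3 * U x))"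
      by (rule sum.swap)
    also have "\<dots> = real n * (\<Sum>x\<in>G. 3 * axis_average w (int m) x * U x)"
      unfolding sum_distrib_left using n_pos
      by (intro sum.cong) (auto simp: axis_average_def simp flip: sum_distrib_right)
    finally show ?thesis .
  qed
  have middle: "c * (\<Sum>x\<in>G. \<Sum>j\<in>{1..n}. \<Sum>k<m div 2. w (x, j) * clip_jump f j (x \<boxplus> axis j (2 * int k)))
      \<le> real n * (\<Sum>x\<in>G. 16 * line_power_mean s w x * U x)"
  proof -
    have half: "real (m div 2) = real m / 2" using \<open>even m\<close> by (simp add: real_of_nat_div)
    have "(\<Sum>x\<in>G. \<Sum>j\<in>{1..n}. \<Sum>k<m div 2. w (x, j) * clip_jump f j (x \<boxplus> axis j (2 * int k))) =
        (\<Sum>j\<in>{1..n}. \<Sum>k<m div 2. \<Sum>x\<in>G. w (x, j) * clip_jump f j (x \<boxplus> axis j (2 * int k)))"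
      by (subst sum.swap, intro sum.cong refl, subst sum.swap, rule refl)
    also have "\<dots> = (\<Sum>j\<in>{1..n}. \<Sum>k<m div 2. \<Sum>x\<in>G. w (x \<boxplus> axis j (- (2 * int k)), j) * clip_jump f j x)"
      using sum_translate_axis[of "\<lambda>x. w (x, j)" "clip_jump f j" j "2 * int k" for j k] by simp
    also have "\<dots> = (\<Sum>x\<in>G. \<Sum>j\<in>{1..n}. \<Sum>k<m div 2. w (x \<boxplus> axis j (- (2 * int k)), j) * clip_jump f j x)"
      by (subst (3) sum.swap, intro sum.cong refl, subst sum.swap, rule refl)
    also have "\<dots> = (\<Sum>x\<in>G. real m / 2 * (\<Sum>j\<in>{1..n}. line_average w j x * clip_jump f j x))"
      using m_pos unfolding line_average_def half sum_distrib_left[of "real m / 2"]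
      by (intro sum.cong refl) (simp flip: sum_distrib_right)
    also have "c * \<dots> = (\<Sum>x\<in>G. real n powr (1 / q) / 2 * (\<Sum>j\<in>{1..n}. line_average w j x * clip_jump f j x))"
      using m_pos unfolding sum_distrib_left[of c] unfolding c_def by (intro sum.cong refl) simp
    also have "\<dots> \<le> (\<Sum>x\<in>G. real n * (16 * line_power_mean s w x * U x))"
    proof (rule sum_mono)
      fix x assume x: "x \<in> G"
      define \<Sigma> where "\<Sigma> = (\<Sum>j\<in>{1..n}. line_average w j x powr s)"
      have la: "0 \<le> line_average w j x" for j
        unfolding line_average_def using w by (auto intro!: sum_nonneg divide_nonneg_nonneg)
      have "0 \<le> \<Sigma>" unfolding \<Sigma>_def by (auto intro: sum_nonneg)
      have "(\<Sum>j\<in>{1..n}. line_average w j x * clip_jump f j x)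
          \<le> \<Sigma> powr (1 / s) * (\<Sum>j\<in>{1..n}. clip_jump f j x powr q) powr (1 / q)"
        unfolding \<Sigma>_def using s1 q la clip_jump_bounds by (intro Hoelder_inequality_sum) auto
      also have "\<dots> \<le> \<Sigma> powr (1 / s) * ((32 * U x) powr q) powr (1 / q)"
        using sum_clip_jump_powr_le[where f = f, OF f x q] q unfolding U_def
        by (intro mult_left_mono powr_mono2) (auto intro: sum_nonneg)
      also have "((32 * U x) powr q) powr (1 / q) = 32 * U x"
        using U[of x] q by (simp add: powr_powr)
      also have "\<Sigma> powr (1 / s) = real n powr (1 / s) * line_power_mean s w x"
        using n_pos \<open>0 \<le> \<Sigma>\<close> unfolding line_power_mean_def \<Sigma>_def[symmetric] by (simp add: powr_divide)
      finally have "real n powr (1 / q) / 2 * (\<Sum>j\<in>{1..n}. line_average w j x * clip_jump f j x)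
          \<le> real n powr (1 / q) / 2 * (real n powr (1 / s) * line_power_mean s w x * (32 * U x))"
        by (intro mult_left_mono) auto
      also have "\<dots> = real n powr (1 / s + 1 / q) * (16 * line_power_mean s w x * U x)"
        by (simp add: powr_add)
      finally show "real n powr (1 / q) / 2 * (\<Sum>j\<in>{1..n}. line_average w j x * clip_jump f j x)
          \<le> real n * (16 * line_power_mean s w x * U x)"
        using s1 n_pos by simp
    qed
    finally show ?thesis by (simp add: sum_distrib_left)
  qed
  have nonneg: "0 \<le> (\<Sum>x\<in>G. 3 * axis_average w a x * U x)" for a
    unfolding axis_average_def using w U
    by (intro sum_nonneg mult_nonneg_nonneg divide_nonneg_nonneg) auto
  have "c * (\<Sum>x\<in>G. \<Sum>j\<in>{1..n}. w (x, j) * \<bar>f (x \<boxplus> axis j (int m)) - f x\<bar>)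
      \<le> c * (real n * (\<Sum>x\<in>G. 3 * axis_average w 0 x * U x))
        + c * (real n * (\<Sum>x\<in>G. 3 * axis_average w (int m) x * U x))
        + real n * (\<Sum>x\<in>G. 16 * line_power_mean s w x * U x)"
    using mult_left_mono[OF split \<open>0 \<le> c\<close>] middle
    unfolding start target by (simp add: distrib_left)
  also have "\<dots> \<le> real n * (\<Sum>x\<in>G. 3 * axis_average w 0 x * U x)
        + real n * (\<Sum>x\<in>G. 3 * axis_average w (int m) x * U x)
        + real n * (\<Sum>x\<in>G. 16 * line_power_mean s w x * U x)"
    using nonneg \<open>0 \<le> c\<close> \<open>c \<le> 1\<close> by (intro add_mono mult_left_le_one_le order_refl) auto
  also have "\<dots> = real n * (\<Sum>x\<in>G. capacity s w x * U x)"
    by (simp add: capacity_def sum.distrib algebra_simps)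
  finally show ?thesis
    using n_pos unfolding c_def[symmetric] U_def[symmetric] by (simp add: divide_le_eq mult.commute)
qed

end

section \<open>The nonlinear lifting\<close>

context discrete_torus
begin

lemma D_long_adj_eq:
  assumes "x \<in> G"
  shows "D_long_adj m n g x = (\<Sum>j\<in>{1..n}. g (x \<boxplus> axis j (- int m), j) - g (x, j)) / real n"
proof -
  have "(\<lambda>i. - (int m * std_basis j i)) = axis j (- int m)" for j by (simp add: axis_def)
  then show ?thesis
    using assms by (simp add: D_long_adj_def torus_sub_eq_translate)
qed

lemma D_sgn_adj_eq:
  assumes "x \<in> G"
  shows "D_sgn_adj m n h x = (\<Sum>\<epsilon>\<in>signs n. h (x \<boxplus> (\<lambda>i. - \<epsilon> i), \<epsilon>) - h (x, \<epsilon>)) / 2 ^ n"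
  using assms by (simp add: D_sgn_adj_def torus_sub_eq_translate)

text \<open>The long divergence is adjoint to the long gradient.\<close>

lemma sum_D_long_adj:
  "(\<Sum>x\<in>G. u x * D_long_adj m n g x) =
     (\<Sum>x\<in>G. \<Sum>j\<in>{1..n}. g (x, j) * (u (x \<boxplus> axis j (int m)) - u x)) / real n"
proof -
  have neg: "axis j (- int m) = (\<lambda>i. - axis j (int m) i)" for j by (auto simp: axis_apply)
  have "(\<Sum>x\<in>G. u x * D_long_adj m n g x) =
      (\<Sum>x\<in>G. \<Sum>j\<in>{1..n}. u x * g (x \<boxplus> axis j (- int m), j) - u x * g (x, j)) / real n"
    by (simp add: D_long_adj_eq sum_distrib_left sum_divide_distrib right_diff_distrib diff_divide_distrib)
  also have "(\<Sum>x\<in>G. \<Sum>j\<in>{1..n}. u x * g (x \<boxplus> axis j (- int m), j) - u x * g (x, j)) =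
      (\<Sum>j\<in>{1..n}. \<Sum>x\<in>G. u x * g (x \<boxplus> axis j (- int m), j) - u x * g (x, j))"
    by (rule sum.swap)
  also have "\<dots> = (\<Sum>j\<in>{1..n}. \<Sum>x\<in>G. g (x, j) * (u (x \<boxplus> axis j (int m)) - u x))"
    using sum_translate_pairing[of u "\<lambda>x. g (x, j)" "axis j (int m)" for j]
    by (intro sum.cong[OF refl, where A = "{1..n}"]) (simp add: neg sum_subtractf right_diff_distrib mult.commute)
  also have "\<dots> = (\<Sum>x\<in>G. \<Sum>j\<in>{1..n}. g (x, j) * (u (x \<boxplus> axis j (int m)) - u x))"
    by (rule sum.swap)
  finally show ?thesis .
qed

text \<open>The sign divergence is adjoint to the sign gradient.\<close>

lemma sum_D_sgn_adj:
  "(\<Sum>x\<in>G. u x * D_sgn_adj m n h x) =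
     (\<Sum>x\<in>G. \<Sum>\<epsilon>\<in>signs n. h (x, \<epsilon>) * (u (x \<boxplus> \<epsilon>) - u x)) / 2 ^ n"
proof -
  have "(\<Sum>x\<in>G. u x * D_sgn_adj m n h x) =
      (\<Sum>x\<in>G. \<Sum>\<epsilon>\<in>signs n. u x * h (x \<boxplus> (\<lambda>i. - \<epsilon> i), \<epsilon>) - u x * h (x, \<epsilon>)) / 2 ^ n"
    by (simp add: D_sgn_adj_eq sum_distrib_left sum_divide_distrib right_diff_distrib diff_divide_distrib)
  also have "(\<Sum>x\<in>G. \<Sum>\<epsilon>\<in>signs n. u x * h (x \<boxplus> (\<lambda>i. - \<epsilon> i), \<epsilon>) - u x * h (x, \<epsilon>)) =
      (\<Sum>\<epsilon>\<in>signs n. \<Sum>x\<in>G. u x * h (x \<boxplus> (\<lambda>i. - \<epsilon> i), \<epsilon>) - u x * h (x, \<epsilon>))"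
    by (rule sum.swap)
  also have "\<dots> = (\<Sum>\<epsilon>\<in>signs n. \<Sum>x\<in>G. h (x, \<epsilon>) * (u (x \<boxplus> \<epsilon>) - u x))"
    using sum_translate_pairing[of u "\<lambda>x. h (x, \<epsilon>)" \<epsilon> for \<epsilon>]
    by (intro sum.cong[OF refl, where A = "signs n"]) (simp add: sum_subtractf right_diff_distrib mult.commute)
  also have "\<dots> = (\<Sum>x\<in>G. \<Sum>\<epsilon>\<in>signs n. h (x, \<epsilon>) * (u (x \<boxplus> \<epsilon>) - u x))"
    by (rule sum.swap)
  finally show ?thesis .
qed

lemma D_sgn_adj_eq_net_inflow:
  assumes "v \<in> G"
  shows "2 ^ n * D_sgn_adj m n h v =
    (\<Sum>e\<in>sgn_dom m n. h e * (of_bool (fst e \<boxplus> snd e = v) - of_bool (fst e = v)))"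
proof -
  have "2 ^ n * D_sgn_adj m n h v = 2 ^ n * (\<Sum>x\<in>G. of_bool (x = v) * D_sgn_adj m n h x)"
    using assms finite_torus by simp
  also have "\<dots> = (\<Sum>x\<in>G. \<Sum>\<epsilon>\<in>signs n. h (x, \<epsilon>) * (of_bool (x \<boxplus> \<epsilon> = v) - of_bool (x = v)))"
    unfolding sum_D_sgn_adj by simp
  finally show ?thesis by (simp add: sum.cartesian_product case_prod_unfold)
qed

lemma capacity_nonneg: "(\<And>\<omega>. 0 \<le> w \<omega>) \<Longrightarrow> 0 \<le> capacity s w x"
  unfolding capacity_def axis_average_def line_power_mean_def
  by (auto intro!: add_nonneg_nonneg mult_nonneg_nonneg divide_nonneg_nonneg sum_nonneg)

text \<open>Pairing the demand with the indicator function of A turns the cut condition into the isoperimetric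
inequality.\<close>

lemma scalar_lifting_within_capacity:
  assumes w: "\<And>\<omega>. 0 \<le> w \<omega>" and g: "\<And>\<omega>. \<bar>g \<omega>\<bar> \<le> w \<omega>"
    and q: "2 \<le> q" and s: "s = q / (q - 1)" and "even m" and nm: "real n \<le> real m powr q"
  shows "\<exists>h. (\<forall>x\<in>G. \<forall>\<epsilon>\<in>signs n. \<bar>h (x, \<epsilon>)\<bar> \<le> capacity s w x) \<and>
    (\<forall>x\<in>G. D_sgn_adj m n h x = real n powr (1 / q) / real m * D_long_adj m n g x)"
proof -
  define c where "c = real n powr (1 / q) / real m"
  define b where "b x = 2 ^ n * (c * D_long_adj m n g x)" for x
  have "0 \<le> c" unfolding c_def by simp
  have pairing: "(\<Sum>x\<in>G. u x * b x) =
      2 ^ n * (c * ((\<Sum>x\<in>G. \<Sum>j\<in>{1..n}. g (x, j) * (u (x \<boxplus> axis j (int m)) - u x)) / real n))" for u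
    unfolding sum_D_long_adj[symmetric] b_def by (simp add: sum_distrib_left mult_ac)
  have "\<exists>h. (\<forall>e\<in>sgn_dom m n. \<bar>h e\<bar> \<le> capacity s w (fst e)) \<and>
      (\<forall>v\<in>G. (\<Sum>e\<in>sgn_dom m n. h e * (of_bool (fst e \<boxplus> snd e = v) - of_bool (fst e = v))) = b v)"
  proof (rule feasible_flow_of_cut_condition)
    show "finite (sgn_dom m n)" "finite G" by (simp_all add: finite_torus)
    show "fst e \<boxplus> snd e \<in> G" for e :: "(nat \<Rightarrow> int) \<times> (nat \<Rightarrow> int)" by simp
    show "0 \<le> capacity s w (fst e)" for e :: "(nat \<Rightarrow> int) \<times> (nat \<Rightarrow> int)" using w by (rule capacity_nonneg)
    show "sum b G = 0" using pairing[of "\<lambda>_. 1"] by simp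
    show "sum b A \<le> (\<Sum>e\<in>sgn_dom m n.
        capacity s w (fst e) * of_bool ((fst e \<in> A) \<noteq> (fst e \<boxplus> snd e \<in> A)))" if "A \<subseteq> G" for A
    proof -
      define f where "f x = (of_bool (x \<in> A) :: real)" for x
      have "sum b A = (\<Sum>x\<in>G. f x * b x)"
        using that finite_torus by (simp add: f_def Int_absorb1)
      also have "\<dots> = 2 ^ n * (c * ((\<Sum>x\<in>G. \<Sum>j\<in>{1..n}. g (x, j) * (f (x \<boxplus> axis j (int m)) - f x)) / real n))"
        by (rule pairing)
      also have "\<dots> \<le> 2 ^ n * (c * ((\<Sum>x\<in>G. \<Sum>j\<in>{1..n}. w (x, j) * \<bar>f (x \<boxplus> axis j (int m)) - f x\<bar>) / real n))"
      proof (intro mult_left_mono divide_right_mono sum_mono)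
        show "g (x, j) * (f (x \<boxplus> axis j (int m)) - f x) \<le> w (x, j) * \<bar>f (x \<boxplus> axis j (int m)) - f x\<bar>" for x j
        proof -
          have "g (x, j) * (f (x \<boxplus> axis j (int m)) - f x) \<le> \<bar>g (x, j)\<bar> * \<bar>f (x \<boxplus> axis j (int m)) - f x\<bar>"
            by (metis abs_ge_self abs_mult)
          also have "\<dots> \<le> w (x, j) * \<bar>f (x \<boxplus> axis j (int m)) - f x\<bar>"
            using g by (intro mult_right_mono) auto
          finally show ?thesis .
        qed
      qed (use \<open>0 \<le> c\<close> in auto)
      also have "\<dots> \<le> 2 ^ n * (\<Sum>x\<in>G. capacity s w x * sgn_variation f x)"
        unfolding c_def
        by (intro mult_left_mono long_boundary_le_sgn_boundary[OF _ w q s \<open>even m\<close> nm]) (auto simp: f_def)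
      also have "\<dots> = (\<Sum>x\<in>G. \<Sum>\<epsilon>\<in>signs n. capacity s w x * \<bar>f (x \<boxplus> \<epsilon>) - f x\<bar>)"
        unfolding sum_distrib_left[of "2 ^ n"]
        by (intro sum.cong refl) (simp add: sgn_variation_def sgn_mean_def flip: sum_distrib_left)
      also have "\<dots> = (\<Sum>x\<in>G. \<Sum>\<epsilon>\<in>signs n. capacity s w x * of_bool ((x \<in> A) \<noteq> (x \<boxplus> \<epsilon> \<in> A)))"
        by (intro sum.cong refl arg_cong2[of _ _ _ _ "(*)"]) (auto simp: f_def)
      finally show ?thesis by (simp only: sum.cartesian_product case_prod_unfold fst_conv snd_conv)
    qed
  qed auto
  then obtain h where "\<forall>e\<in>sgn_dom m n. \<bar>h e\<bar> \<le> capacity s w (fst e)"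
    and "\<forall>v\<in>G. 2 ^ n * D_sgn_adj m n h v = b v"
    using D_sgn_adj_eq_net_inflow by auto
  moreover have "D_sgn_adj m n h v = c * D_long_adj m n g v" if "2 ^ n * D_sgn_adj m n h v = b v" for v
    using that by (simp add: b_def)
  ultimately show ?thesis unfolding c_def[symmetric] by (intro exI[of _ h]) auto
qed

lemma sum_axis_average: "(\<Sum>x\<in>G. axis_average v a x) = (\<Sum>x\<in>G. \<Sum>j\<in>{1..n}. v (x, j)) / real n"
proof -
  have "(\<Sum>x\<in>G. \<Sum>j\<in>{1..n}. v (x \<boxplus> axis j (- a), j)) = (\<Sum>j\<in>{1..n}. \<Sum>x\<in>G. v (x, j))"
    by (subst sum.swap) (simp add: sum_translate[of "\<lambda>x. v (x, j)" for j])
  also have "\<dots> = (\<Sum>x\<in>G. \<Sum>j\<in>{1..n}. v (x, j))" by (rule sum.swap)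
  finally show ?thesis
    unfolding axis_average_def sum_divide_distrib[symmetric] by simp
qed

lemma sum_line_average:
  assumes "2 \<le> m"
  shows "(\<Sum>x\<in>G. \<Sum>j\<in>{1..n}. line_average v j x) = (\<Sum>x\<in>G. \<Sum>j\<in>{1..n}. v (x, j))"
proof -
  have "(\<Sum>x\<in>G. line_average v j x) = (\<Sum>x\<in>G. v (x, j))" for j
  proof -
    have "(\<Sum>x\<in>G. \<Sum>k<m div 2. v (x \<boxplus> axis j (- (2 * int k)), j)) = (\<Sum>k<m div 2. \<Sum>x\<in>G. v (x, j))"
      by (subst sum.swap) (simp only: sum_translate[of "\<lambda>x. v (x, j)"])
    then show ?thesis
      using assms by (simp add: line_average_def sum_divide_distrib[symmetric])
  qed
  then have "(\<Sum>j\<in>{1..n}. \<Sum>x\<in>G. line_average v j x) = (\<Sum>j\<in>{1..n}. \<Sum>x\<in>G. v (x, j))" by simp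
  then show ?thesis by (subst (1 2) sum.swap)
qed

text \<open>Jensen's inequality, applied to each of the averages of which the capacity is composed. For the power mean
it is applied with exponent \<rho> / s, which is why \<rho> must be at least s; in the end s is the
conjugate exponent of q and \<rho> that of p \<le> q.\<close>

lemma capacity_powr_le:
  assumes w: "\<And>\<omega>. 0 \<le> w \<omega>" and s: "1 \<le> s" "s \<le> \<rho>" and "2 \<le> m"
  shows "capacity s w x powr \<rho> \<le> 22 powr \<rho> *
    (3 / 22 * axis_average (\<lambda>\<omega>. w \<omega> powr \<rho>) 0 x
     + 3 / 22 * axis_average (\<lambda>\<omega>. w \<omega> powr \<rho>) (int m) x
     + 16 / 22 * ((\<Sum>j\<in>{1..n}. line_average (\<lambda>\<omega>. w \<omega> powr \<rho>) j x) / real n))"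
proof -
  have \<rho>: "1 \<le> \<rho>" using s by simp
  have axis: "axis_average w a x powr \<rho> \<le> axis_average (\<lambda>\<omega>. w \<omega> powr \<rho>) a x" for a
    using powr_average_le[OF \<rho>, of "{1..n}" "\<lambda>j. w (x \<boxplus> axis j (- a), j)"] w n_pos
    by (simp add: axis_average_def)
  have line: "line_average w j x powr \<rho> \<le> line_average (\<lambda>\<omega>. w \<omega> powr \<rho>) j x" for j
    using powr_average_le[OF \<rho>, of "{..<m div 2}" "\<lambda>k. w (x \<boxplus> axis j (- (2 * int k)), j)"] w \<open>2 \<le> m\<close>
    by (simp add: line_average_def lessThan_empty_iff)
  have la: "0 \<le> line_average w j x" for j
    unfolding line_average_def using w by (auto intro!: sum_nonneg divide_nonneg_nonneg)
  have mean: "line_power_mean s w x powr \<rho> \<le> (\<Sum>j\<in>{1..n}. line_average (\<lambda>\<omega>. w \<omega> powr \<rho>) j x) / real n"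
  proof -
    have "line_power_mean s w x powr \<rho> = ((\<Sum>j\<in>{1..n}. line_average w j x powr s) / real n) powr (\<rho> / s)"
      by (simp add: line_power_mean_def powr_powr)
    also have "\<dots> \<le> (\<Sum>j\<in>{1..n}. (line_average w j x powr s) powr (\<rho> / s)) / real n"
      using powr_average_le[of "\<rho> / s" "{1..n}" "\<lambda>j. line_average w j x powr s"] s n_pos by simp
    also have "\<dots> = (\<Sum>j\<in>{1..n}. line_average w j x powr \<rho>) / real n"
      using s by (simp add: powr_powr)
    also have "\<dots> \<le> (\<Sum>j\<in>{1..n}. line_average (\<lambda>\<omega>. w \<omega> powr \<rho>) j x) / real n"
      using line by (intro divide_right_mono sum_mono) auto
    finally show ?thesis .
  qed
  define y where "y i = (if i = 0 then axis_average w 0 x else if i = 1 then axis_average w (int m) x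
    else line_power_mean s w x)" for i :: nat
  \<comment> \<open>The three averages have coefficients 3, 3 and 16; dividing by 22 makes them a convex combination.\<close>
  define \<theta> where "\<theta> i = (if i = 2 then 16 / 22 else 3 / 22 :: real)" for i :: nat
  have y: "0 \<le> y i" for i
    unfolding y_def axis_average_def line_power_mean_def using w
    by (auto intro!: sum_nonneg divide_nonneg_nonneg)
  have "(\<Sum>i\<in>{0, 1, 2}. \<theta> i * y i) powr \<rho> \<le> (\<Sum>i\<in>{0, 1, 2}. \<theta> i * y i powr \<rho>)"
    by (rule powr_weighted_mean_le[OF \<rho>]) (auto simp: \<theta>_def y)
  also have "(\<Sum>i\<in>{0, 1, 2}. \<theta> i * y i) = capacity s w x / 22"
    by (simp add: \<theta>_def y_def capacity_def)
  also have "(\<Sum>i\<in>{0, 1, 2}. \<theta> i * y i powr \<rho>) = 3 / 22 * axis_average w 0 x powr \<rho>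
      + 3 / 22 * axis_average w (int m) x powr \<rho> + 16 / 22 * line_power_mean s w x powr \<rho>"
    by (simp add: \<theta>_def y_def)
  also have "\<dots> \<le> 3 / 22 * axis_average (\<lambda>\<omega>. w \<omega> powr \<rho>) 0 x
     + 3 / 22 * axis_average (\<lambda>\<omega>. w \<omega> powr \<rho>) (int m) x
     + 16 / 22 * ((\<Sum>j\<in>{1..n}. line_average (\<lambda>\<omega>. w \<omega> powr \<rho>) j x) / real n)"
    using axis mean by (intro add_mono mult_left_mono) auto
  finally show ?thesis
    using capacity_nonneg[where w = w, OF w, of s x] by (simp add: powr_divide divide_le_eq mult.commute)
qed

lemma capacity_le_of_bounded:
  assumes w: "\<And>\<omega>. 0 \<le> w \<omega>" and M: "\<And>\<omega>. \<omega> \<in> long_dom m n \<Longrightarrow> w \<omega> \<le> M"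
    and s: "1 \<le> s" and "2 \<le> m" and "x \<in> G"
  shows "capacity s w x \<le> 22 * M"
proof -
  have "0 \<le> M" using M[of "(x, 1)"] w[of "(x, 1)"] n_pos \<open>x \<in> G\<close> by auto
  have axis: "axis_average w a x \<le> M" for a
  proof -
    have "(\<Sum>j\<in>{1..n}. w (x \<boxplus> axis j (- a), j)) \<le> real (card {1..n}) * M"
      by (rule sum_bounded_above) (use M in auto)
    then show ?thesis using n_pos by (simp add: axis_average_def divide_le_eq mult.commute)
  qed
  have line: "line_average w j x \<le> M" if "j \<in> {1..n}" for j
  proof -
    have "(\<Sum>k<m div 2. w (x \<boxplus> axis j (- (2 * int k)), j)) \<le> real (card {..<m div 2}) * M"
      by (rule sum_bounded_above) (use M that in auto)
    then show ?thesis
      using \<open>2 \<le> m\<close> by (simp add: line_average_def divide_le_eq mult.commute)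
  qed
  have la: "0 \<le> line_average w j x" for j
    unfolding line_average_def using w by (auto intro!: sum_nonneg divide_nonneg_nonneg)
  have "(\<Sum>j\<in>{1..n}. line_average w j x powr s) \<le> real (card {1..n}) * M powr s"
    using line la s by (intro sum_bounded_above powr_mono2) auto
  then have "line_power_mean s w x \<le> (M powr s) powr (1 / s)"
    unfolding line_power_mean_def using n_pos s
    by (intro powr_mono2) (auto simp: divide_le_eq mult.commute intro!: sum_nonneg divide_nonneg_nonneg)
  also have "\<dots> = M" using \<open>0 \<le> M\<close> s by (simp add: powr_powr)
  finally show ?thesis
    using axis[of 0] axis[of "int m"] unfolding capacity_def by linarith
qed

text \<open>Averaging the pointwise bound over the torus replaces each average of w^\<rho> by the mean of w^\<rho>, as
all of them are built from translations.\<close>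

lemma power_mean_capacity_le:
  assumes w: "\<And>\<omega>. 0 \<le> w \<omega>" and s: "1 \<le> s" "ereal s \<le> r" and "2 \<le> m"
    and \<psi>: "\<And>\<omega>. \<omega> \<in> sgn_dom m n \<Longrightarrow> 0 \<le> \<psi> \<omega> \<and> \<psi> \<omega> \<le> capacity s w (fst \<omega>)"
  shows "power_mean r (sgn_dom m n) \<psi> \<le> 22 * power_mean r (long_dom m n) w"
proof (cases r)
  case (real \<rho>)
  then have \<rho>: "s \<le> \<rho>" "1 \<le> \<rho>" using s by auto
  define v where "v \<omega> = w \<omega> powr \<rho>" for \<omega>
  define S where "S = (\<Sum>x\<in>G. \<Sum>j\<in>{1..n}. v (x, j))"
  have "(\<Sum>\<omega>\<in>sgn_dom m n. \<psi> \<omega> powr \<rho>) \<le> (\<Sum>\<omega>\<in>sgn_dom m n. capacity s w (fst \<omega>) powr \<rho>)"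
    using \<psi> \<rho> by (intro sum_mono powr_mono2) auto
  also have "\<dots> = 2 ^ n * (\<Sum>x\<in>G. capacity s w x powr \<rho>)"
    by (simp add: sum.cartesian_product' sum_distrib_left)
  also have "\<dots> \<le> 2 ^ n * (\<Sum>x\<in>G. 22 powr \<rho> * (3 / 22 * axis_average v 0 x + 3 / 22 * axis_average v (int m) x
     + 16 / 22 * ((\<Sum>j\<in>{1..n}. line_average v j x) / real n)))"
    unfolding v_def using capacity_powr_le[where w = w, OF w \<open>1 \<le> s\<close> \<open>s \<le> \<rho>\<close> \<open>2 \<le> m\<close>]
    by (intro mult_left_mono sum_mono) auto
  also have "\<dots> = 2 ^ n * (22 powr \<rho> * (3 / 22 * (S / real n) + 3 / 22 * (S / real n) + 16 / 22 * (S / real n)))"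
    using sum_axis_average[of v] sum_line_average[OF \<open>2 \<le> m\<close>, of v]
    by (simp add: S_def sum.distrib flip: sum_distrib_left sum_divide_distrib)
  also have "\<dots> = 2 ^ n * (22 powr \<rho> * (S / real n))" by simp
  finally have "(\<Sum>\<omega>\<in>sgn_dom m n. \<psi> \<omega> powr \<rho>) / real (card (sgn_dom m n))
      \<le> 22 powr \<rho> * (S / real n) / real (card G)"
    using finite_torus torus_nonempty
    by (simp add: card_cartesian_product divide_le_eq card_gt_0_iff mult_ac)
  then show ?thesis
    using \<rho> unfolding real
    by (intro power_mean_ereal_le)
       (auto simp: S_def v_def card_cartesian_product sum.cartesian_product case_prod_unfold mult.commute)
next
  case PInf
  show ?thesis
    unfolding PInf
  proof (rule power_mean_infinity_le)
    show "finite (sgn_dom m n)" "sgn_dom m n \<noteq> {}" "finite (long_dom m n)"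
      using finite_torus torus_nonempty by auto
    show "\<psi> \<omega>' \<le> 22 * M" if "\<omega>' \<in> sgn_dom m n" and "\<And>\<omega>. \<omega> \<in> long_dom m n \<Longrightarrow> w \<omega> \<le> M" for M \<omega>'
    proof -
      have "capacity s w (fst \<omega>') \<le> 22 * M"
        using that by (intro capacity_le_of_bounded[where w = w, OF w _ \<open>1 \<le> s\<close> \<open>2 \<le> m\<close>]) auto
      then show ?thesis using \<psi>[OF that(1)] by simp
    qed
  qed
qed (use s in auto)

lemma bounded_lifting_22:
  assumes q: "2 \<le> q" and p: "1 \<le> p" "p \<le> q" and "even m" and nm: "real n \<le> real m powr q"
  shows "bounded_lifting m n q (conj_exponent p) 22"
  unfolding bounded_lifting_def
proof (intro allI impI)
  fix N :: nat and g :: "(nat \<Rightarrow> int) \<times> nat \<Rightarrow> nat \<Rightarrow> real"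
  assume N: "1 \<le> N"
  define s where "s = q / (q - 1)"
  define w where "w \<omega> = linf_norm N (g \<omega>)" for \<omega>
  have w: "0 \<le> w \<omega>" for \<omega> unfolding w_def using N by (rule linf_norm_nonneg)
  have "2 \<le> m" using m_pos \<open>even m\<close> by presburger
  have "\<exists>h. (\<forall>x\<in>G. \<forall>\<epsilon>\<in>signs n. \<bar>h (x, \<epsilon>)\<bar> \<le> capacity s w x) \<and>
    (\<forall>x\<in>G. D_sgn_adj m n h x = real n powr (1 / q) / real m * D_long_adj m n (\<lambda>\<omega>. g \<omega> i) x)"
    if "i \<in> {1..N}" for i
    using that w unfolding w_def
    by (intro scalar_lifting_within_capacity[OF _ _ q s_def \<open>even m\<close> nm] abs_le_linf_norm) auto
  then obtain h where h: "\<And>i x \<epsilon>. \<lbrakk>i \<in> {1..N}; x \<in> G; \<epsilon> \<in> signs n\<rbrakk> \<Longrightarrow> \<bar>h i (x, \<epsilon>)\<bar> \<le> capacity s w x"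
    and eq: "\<And>i x. \<lbrakk>i \<in> {1..N}; x \<in> G\<rbrakk> \<Longrightarrow>
      D_sgn_adj m n (h i) x = real n powr (1 / q) / real m * D_long_adj m n (\<lambda>\<omega>. g \<omega> i) x"
    by metis
  have "1 \<le> s" unfolding s_def using q by simp
  have r: "ereal s \<le> conj_exponent p"
    unfolding conj_exponent_def s_def using p q by (auto simp: field_simps)
  have "Lr_norm (conj_exponent p) N (sgn_dom m n) (\<lambda>\<omega> i. h i \<omega>)
      \<le> 22 * Lr_norm (conj_exponent p) N (long_dom m n) g"
    unfolding Lr_norm_eq_power_mean w_def[symmetric]
    using linf_norm_nonneg[OF N] h N
    by (intro power_mean_capacity_le[where w = w, OF w \<open>1 \<le> s\<close> r \<open>2 \<le> m\<close>]) (auto intro!: linf_norm_le)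
  then show "\<exists>h. (\<forall>x\<in>G. \<forall>i\<in>{1..N}. D_sgn_adj m n (\<lambda>\<omega>. h \<omega> i) x =
        real n powr (1 / q) / real m * D_long_adj m n (\<lambda>\<omega>. g \<omega> i) x) \<and>
      Lr_norm (conj_exponent p) N (sgn_dom m n) h \<le> 22 * Lr_norm (conj_exponent p) N (long_dom m n) g"
    using eq by (intro exI[of _ "\<lambda>\<omega> i. h i \<omega>"]) auto
qed

end

section \<open>Linear liftings and their regular norms\<close>

lemma linear_operator_on_sum:
  assumes S: "linear_operator_on \<Omega> \<Omega>' S" and "finite B" and \<omega>': "\<omega>' \<in> \<Omega>'"
  shows "S (\<lambda>\<omega>. \<Sum>b\<in>B. c b * f b \<omega>) \<omega>' = (\<Sum>b\<in>B. c b * S (f b) \<omega>')"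
proof -
  have add: "S (\<lambda>\<omega>. f \<omega> + g \<omega>) \<omega>' = S f \<omega>' + S g \<omega>'" for f g
    using S \<omega>' unfolding linear_operator_on_def by blast
  have scale: "S (\<lambda>\<omega>. a * f \<omega>) \<omega>' = a * S f \<omega>'" for a f
    using S \<omega>' unfolding linear_operator_on_def by blast
  show ?thesis
    using \<open>finite B\<close>
  proof (induction B rule: finite_induct)
    case empty
    show ?case using scale[of 0 "\<lambda>_. 0"] by simp
  next
    case (insert b B)
    then show ?case by (simp add: add scale)
  qed
qed

lemma linear_operator_on_kernel:
  assumes S: "linear_operator_on \<Omega> \<Omega>' S" and "finite \<Omega>" and \<omega>': "\<omega>' \<in> \<Omega>'"
  shows "S f \<omega>' = (\<Sum>z\<in>\<Omega>. f z * S (\<lambda>\<omega>. of_bool (\<omega> = z)) \<omega>')"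
proof -
  have delta: "f \<omega> = (\<Sum>z\<in>\<Omega>. f z * of_bool (\<omega> = z))" if "\<omega> \<in> \<Omega>" for \<omega>
  proof -
    have "\<Omega> \<inter> {z. \<omega> = z} = {\<omega>}" using that by auto
    then show ?thesis using \<open>finite \<Omega>\<close> by simp
  qed
  have agree: "S f \<omega>' = S g \<omega>'" if "\<And>\<omega>. \<omega> \<in> \<Omega> \<Longrightarrow> f \<omega> = g \<omega>" for g
    using S \<omega>' that unfolding linear_operator_on_def by blast
  have "S f \<omega>' = S (\<lambda>\<omega>. \<Sum>z\<in>\<Omega>. f z * of_bool (\<omega> = z)) \<omega>'"
    by (intro agree delta)
  then show ?thesis
    using linear_operator_on_sum[OF S \<open>finite \<Omega>\<close> \<omega>', of f "\<lambda>z \<omega>. of_bool (\<omega> = z)"] by simp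
qed

text \<open>The test function has one coordinate for each row of the kernel, namely the sign pattern of that row. It
has sup norm at most 1 everywhere, and in every row some coordinate of its image is the absolute row sum.\<close>

lemma mean_kernel_mass_le_regular_norm:
  assumes S: "linear_operator_on \<Omega> \<Omega>' S" and fin: "finite \<Omega>" "\<Omega> \<noteq> {}" "finite \<Omega>'" "\<Omega>' \<noteq> {}"
    and r: "1 \<le> r"
  shows "ereal ((\<Sum>\<omega>'\<in>\<Omega>'. \<Sum>z\<in>\<Omega>. \<bar>S (\<lambda>\<omega>. of_bool (\<omega> = z)) \<omega>'\<bar>) / real (card \<Omega>'))
    \<le> regular_norm r \<Omega> \<Omega>' S"
proof -
  define K where "K \<omega>' z = S (\<lambda>\<omega>. of_bool (\<omega> = z)) \<omega>'" for \<omega>' z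
  define N where "N = card \<Omega>'"
  have N: "1 \<le> N" unfolding N_def using fin by (simp add: Suc_le_eq card_gt_0_iff)
  obtain e where e: "bij_betw e {1..N} \<Omega>'"
    using ex_bij_betw_nat_finite_1[OF fin(3)] unfolding N_def by blast
  define F where "F \<omega> i = sgn (K (e i) \<omega>)" for \<omega> i
  have "linf_norm N (F \<omega>) \<le> 1" for \<omega>
    using N by (intro linf_norm_le) (auto simp: F_def abs_sgn_eq)
  then have F: "Lr_norm r N \<Omega> F \<le> 1"
    unfolding Lr_norm_eq_power_mean using linf_norm_nonneg[OF N] fin by (intro power_mean_le_one r) auto
  have "(\<Sum>z\<in>\<Omega>. \<bar>K \<omega>' z\<bar>) \<le> linf_norm N (coordinatewise S F \<omega>')" if \<omega>': "\<omega>' \<in> \<Omega>'" for \<omega>'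
  proof -
    obtain i where i: "i \<in> {1..N}" "e i = \<omega>'"
      using e \<omega>' unfolding bij_betw_def by blast
    have "coordinatewise S F \<omega>' i = (\<Sum>z\<in>\<Omega>. F z i * K \<omega>' z)"
      unfolding coordinatewise_def K_def by (rule linear_operator_on_kernel[OF S fin(1) \<omega>'])
    also have "\<dots> = (\<Sum>z\<in>\<Omega>. \<bar>K \<omega>' z\<bar>)"
      by (simp add: F_def i(2) abs_sgn mult.commute)
    finally show ?thesis
      using abs_le_linf_norm[of i N "coordinatewise S F \<omega>'"] i by simp
  qed
  then have "(\<Sum>\<omega>'\<in>\<Omega>'. \<Sum>z\<in>\<Omega>. \<bar>K \<omega>' z\<bar>) / real (card \<Omega>')
      \<le> (\<Sum>\<omega>'\<in>\<Omega>'. linf_norm N (coordinatewise S F \<omega>')) / real (card \<Omega>')"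
    by (intro divide_right_mono sum_mono) auto
  also have "\<dots> \<le> Lr_norm r N \<Omega>' (coordinatewise S F)"
    unfolding Lr_norm_eq_power_mean
    using fin linf_norm_nonneg[OF N] by (intro mean_le_power_mean r) auto
  finally have "ereal ((\<Sum>\<omega>'\<in>\<Omega>'. \<Sum>z\<in>\<Omega>. \<bar>K \<omega>' z\<bar>) / real (card \<Omega>'))
      \<le> ereal (Lr_norm r N \<Omega>' (coordinatewise S F))" by simp
  also have "\<dots> \<le> operator_norm r N \<Omega> \<Omega>' (coordinatewise S)"
    unfolding operator_norm_def using F by (intro SUP_upper) auto
  also have "\<dots> \<le> regular_norm r \<Omega> \<Omega>' S"
    unfolding regular_norm_def using N by (intro SUP_upper) auto
  finally show ?thesis unfolding K_def .
qed

context discrete_torus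
begin

text \<open>The distance between the j-th coordinates of x and y on the cycle of length 2m, used as a potential that
changes by at most 1 along sign edges and by m along the long edge at x in direction j.\<close>

definition circular_distance :: "nat \<Rightarrow> (nat \<Rightarrow> int) \<Rightarrow> (nat \<Rightarrow> int) \<Rightarrow> real" where
  "circular_distance j x y =
     (let d = (y j - x j) mod (2 * int m) in real_of_int (min d (2 * int m - d)))"

lemma circular_distance_Lipschitz:
  assumes j: "j \<in> {1..n}" and \<epsilon>: "\<epsilon> \<in> signs n"
  shows "\<bar>circular_distance j x (y \<boxplus> \<epsilon>) - circular_distance j x y\<bar> \<le> 1"
proof -
  define M where "M = 2 * int m"
  define d where "d = (y j - x j) mod M"
  have "0 < M" using m_pos by (simp add: M_def)
  then have d: "0 \<le> d" "d < M" by (auto simp: d_def)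
  have "((y \<boxplus> \<epsilon>) j - x j) mod M = (y j + \<epsilon> j - x j) mod M"
    using j by (simp add: translate_def M_def mod_simps)
  also have "\<dots> = (d + \<epsilon> j) mod M"
    unfolding d_def by (simp add: mod_simps algebra_simps)
  finally have step: "((y \<boxplus> \<epsilon>) j - x j) mod M = (d + \<epsilon> j) mod M" .
  have "(d + \<epsilon> j) mod M = (if d + \<epsilon> j = M then 0 else if d + \<epsilon> j = -1 then M - 1 else d + \<epsilon> j)"
  proof -
    have "(-1) mod M = M - 1" using \<open>0 < M\<close> by (simp add: zmod_minus1)
    moreover have "0 \<le> d + \<epsilon> j \<and> d + \<epsilon> j < M" if "d + \<epsilon> j \<noteq> M" "d + \<epsilon> j \<noteq> -1"
      using sign_cases[OF \<epsilon> j] d that by auto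
    ultimately show ?thesis by auto
  qed
  then have "\<bar>min ((d + \<epsilon> j) mod M) (M - (d + \<epsilon> j) mod M) - min d (M - d)\<bar> \<le> 1"
    using sign_cases[OF \<epsilon> j] d by (auto simp: min_def)
  then show ?thesis
    unfolding circular_distance_def Let_def M_def[symmetric] step d_def[symmetric] by linarith
qed

lemma circular_distance_long_edge:
  assumes "j \<in> {1..n}"
  shows "circular_distance j x (x \<boxplus> axis j (int m)) - circular_distance j x x = real m"
proof -
  have "((x \<boxplus> axis j (int m)) j - x j) mod (2 * int m) = int m mod (2 * int m)"
    using assms by (simp add: translate_def axis_apply mod_simps)
  also have "\<dots> = int m" using m_pos by simp
  finally show ?thesis using m_pos by (simp add: circular_distance_def)
qed

text \<open>Testing with the potential: a flow whose divergence is that of a single long edge must raise the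
potential by m for every unit transported, but gains at most 1 per unit on each sign edge.\<close>

lemma lifted_edge_mass:
  assumes lift: "\<And>y. y \<in> G \<Longrightarrow> D_sgn_adj m n h y = c * D_long_adj m n (\<lambda>\<omega>. of_bool (\<omega> = (x, j))) y"
    and x: "x \<in> G" and j: "j \<in> {1..n}"
  shows "c * real m / real n \<le> (\<Sum>\<omega>'\<in>sgn_dom m n. \<bar>h \<omega>'\<bar>) / 2 ^ n"
proof -
  define u where "u = circular_distance j x"
  have "(\<Sum>y\<in>G. \<Sum>i\<in>{1..n}. of_bool ((y, i) = (x, j)) * (u (y \<boxplus> axis i (int m)) - u y))
      = (\<Sum>\<omega>\<in>long_dom m n. of_bool (\<omega> = (x, j)) * (u (fst \<omega> \<boxplus> axis (snd \<omega>) (int m)) - u (fst \<omega>)))"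
    by (simp only: sum.cartesian_product case_prod_unfold prod.collapse fst_conv snd_conv)
  also have "\<dots> = u (x \<boxplus> axis j (int m)) - u x"
  proof -
    have "long_dom m n \<inter> {\<omega>. \<omega> = (x, j)} = {(x, j)}" using x j by auto
    then show ?thesis using finite_torus by simp
  qed
  also have "\<dots> = real m" unfolding u_def by (rule circular_distance_long_edge[OF j])
  finally have "c * real m / real n = c * (\<Sum>y\<in>G. u y * D_long_adj m n (\<lambda>\<omega>. of_bool (\<omega> = (x, j))) y)"
    by (simp add: sum_D_long_adj)
  also have "\<dots> = (\<Sum>y\<in>G. u y * D_sgn_adj m n h y)"
    by (simp add: lift sum_distrib_left mult_ac)
  also have "\<dots> = (\<Sum>y\<in>G. \<Sum>\<epsilon>\<in>signs n. h (y, \<epsilon>) * (u (y \<boxplus> \<epsilon>) - u y)) / 2 ^ n"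
    by (rule sum_D_sgn_adj)
  also have "\<dots> \<le> (\<Sum>y\<in>G. \<Sum>\<epsilon>\<in>signs n. \<bar>h (y, \<epsilon>)\<bar>) / 2 ^ n"
  proof (intro divide_right_mono sum_mono)
    show "h (y, \<epsilon>) * (u (y \<boxplus> \<epsilon>) - u y) \<le> \<bar>h (y, \<epsilon>)\<bar>" if "\<epsilon> \<in> signs n" for y \<epsilon>
    proof -
      have "h (y, \<epsilon>) * (u (y \<boxplus> \<epsilon>) - u y) \<le> \<bar>h (y, \<epsilon>)\<bar> * \<bar>u (y \<boxplus> \<epsilon>) - u y\<bar>"
        by (metis abs_ge_self abs_mult)
      also have "\<dots> \<le> \<bar>h (y, \<epsilon>)\<bar> * 1"
        using circular_distance_Lipschitz[OF j that] unfolding u_def by (intro mult_left_mono) auto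
      finally show ?thesis by simp
    qed
  qed auto
  finally show ?thesis by (simp add: sum.cartesian_product case_prod_unfold)
qed

lemma regular_norm_linear_lifting_ge:
  assumes S: "linear_lifting m n q S" and r: "1 \<le> r"
  shows "ereal (real n powr (1 / q)) \<le> regular_norm r (long_dom m n) (sgn_dom m n) S"
proof -
  define c where "c = real n powr (1 / q) / real m"
  define K where "K \<omega>' z = S (\<lambda>\<omega>. of_bool (\<omega> = z)) \<omega>'" for \<omega>' z
  have lin: "linear_operator_on (long_dom m n) (sgn_dom m n) S"
    and lift: "\<And>g x. x \<in> G \<Longrightarrow> D_sgn_adj m n (S g) x = c * D_long_adj m n g x"
    using S unfolding linear_lifting_def c_def by auto
  have edge: "2 ^ n * (c * real m / real n) \<le> (\<Sum>\<omega>'\<in>sgn_dom m n. \<bar>K \<omega>' z\<bar>)" if "z \<in> long_dom m n" for z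
  proof -
    obtain x j where z: "z = (x, j)" "x \<in> G" "j \<in> {1..n}" using \<open>z \<in> long_dom m n\<close> by auto
    show ?thesis
      using lifted_edge_mass[OF lift z(2,3)] unfolding K_def z(1) by (simp add: le_divide_eq mult.commute)
  qed
  have "real (card (sgn_dom m n)) * real n powr (1 / q) = (\<Sum>z\<in>long_dom m n. 2 ^ n * (c * real m / real n))"
    using m_pos n_pos unfolding c_def by (simp add: card_cartesian_product)
  also have "\<dots> \<le> (\<Sum>z\<in>long_dom m n. \<Sum>\<omega>'\<in>sgn_dom m n. \<bar>K \<omega>' z\<bar>)"
    by (rule sum_mono) (rule edge)
  also have "\<dots> = (\<Sum>\<omega>'\<in>sgn_dom m n. \<Sum>z\<in>long_dom m n. \<bar>K \<omega>' z\<bar>)"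
    by (rule sum.swap)
  finally have "real n powr (1 / q)
      \<le> (\<Sum>\<omega>'\<in>sgn_dom m n. \<Sum>z\<in>long_dom m n. \<bar>K \<omega>' z\<bar>) / real (card (sgn_dom m n))"
    using finite_torus torus_nonempty
    by (simp add: le_divide_eq card_gt_0_iff card_cartesian_product mult.commute)
  then have "ereal (real n powr (1 / q))
      \<le> ereal ((\<Sum>\<omega>'\<in>sgn_dom m n. \<Sum>z\<in>long_dom m n. \<bar>K \<omega>' z\<bar>) / real (card (sgn_dom m n)))"
    by simp
  also have "\<dots> \<le> regular_norm r (long_dom m n) (sgn_dom m n) S"
    unfolding K_def using finite_torus torus_nonempty n_pos
    by (intro mean_kernel_mass_le_regular_norm[OF lin _ _ _ _ r]) auto
  finally show ?thesis .
qed

text \<open>An index (j, k, b) stands for the edge number 2k or 2k + 1, according to b, of a zigzag path replacing a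
long edge in direction j. The path starts with a sign vector \<epsilon>, alternates between \<epsilon> and
reflect j \<epsilon>, and has m edges.\<close>

definition zigzag_steps :: "(nat \<times> nat \<times> bool) set" where
  "zigzag_steps = {1..n} \<times> {..<m div 2} \<times> UNIV"

text \<open>The displacement from the start y of a sign edge (y, \<epsilon>) back to the start of the long edge whose
zigzag path uses it as the edge with the given index. If b holds, the preceding step was reflect j
\<epsilon>, and the path began with that vector.\<close>

definition zigzag_offset :: "nat \<times> nat \<times> bool \<Rightarrow> (nat \<Rightarrow> int) \<Rightarrow> nat \<Rightarrow> int" where
  "zigzag_offset = (\<lambda>(j, k, b) \<epsilon> i.
     axis j (- (2 * int k * \<epsilon> j)) i - (if b then reflect j \<epsilon> i else 0))"

definition zigzag_lifting ::
  "real \<Rightarrow> ((nat \<Rightarrow> int) \<times> nat \<Rightarrow> real) \<Rightarrow> (nat \<Rightarrow> int) \<times> (nat \<Rightarrow> int) \<Rightarrow> real" where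
  "zigzag_lifting C g = (\<lambda>(y, \<epsilon>).
     C * ((\<Sum>\<iota>\<in>zigzag_steps. g (y \<boxplus> zigzag_offset \<iota> \<epsilon>, fst \<iota>)) / real (card zigzag_steps)))"

lemma finite_zigzag_steps: "finite zigzag_steps"
  by (simp add: zigzag_steps_def)

lemma card_zigzag_steps: "even m \<Longrightarrow> card zigzag_steps = n * m"
  by (simp add: zigzag_steps_def card_cartesian_product)

text \<open>The inflow and outflow in direction j at x cancel along each zigzag path, except at its two ends. Paths
moving in direction -e_j are admissible as well, because m e_j = - m e_j on the torus; using both
directions makes the lifting an average without any restriction on \<epsilon>.\<close>

lemma zigzag_telescope:
  fixes g :: "(nat \<Rightarrow> int) \<times> nat \<Rightarrow> real"
  assumes j: "j \<in> {1..n}" and x: "x \<in> G" and "even m"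
  shows "(\<Sum>\<epsilon>\<in>signs n. \<Sum>k<m div 2. \<Sum>b\<in>UNIV.
      g (x \<boxplus> (\<lambda>i. - \<epsilon> i) \<boxplus> zigzag_offset (j, k, b) \<epsilon>, j) - g (x \<boxplus> zigzag_offset (j, k, b) \<epsilon>, j))
    = 2 ^ n * (g (x \<boxplus> axis j (- int m), j) - g (x, j))" (is "?lhs = _")
proof -
  define a where "a \<epsilon> k = g (x \<boxplus> axis j (- (2 * int k * \<epsilon> j)), j)" for \<epsilon> :: "nat \<Rightarrow> int" and k :: nat
  define r where "r \<epsilon> k = g (x \<boxplus> zigzag_offset (j, k, True) \<epsilon>, j)" for \<epsilon> k
  have straight: "zigzag_offset (j, k, False) \<epsilon> = axis j (- (2 * int k * \<epsilon> j))" for k \<epsilon>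
    by (auto simp: zigzag_offset_def)
  \<comment> \<open>A path that arrives at x by its edge 2k leaves x by its edge 2k + 1.\<close>
  have first: "x \<boxplus> (\<lambda>i. - \<epsilon> i) \<boxplus> axis j (- (2 * int k * \<epsilon> j)) = x \<boxplus> zigzag_offset (j, k, True) (reflect j \<epsilon>)"
    if "\<epsilon> \<in> signs n" for \<epsilon> k
    unfolding translate_translate using j
    by (intro translate_cong) (auto simp: zigzag_offset_def reflect_def)
  \<comment> \<open>A path that arrives at x by its edge 2k + 1 leaves x by its edge 2(k + 1).\<close>
  have second: "x \<boxplus> (\<lambda>i. - \<epsilon> i) \<boxplus> zigzag_offset (j, k, True) \<epsilon> = x \<boxplus> axis j (- (2 * int (Suc k) * \<epsilon> j))" for \<epsilon> k
    unfolding translate_translate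
    by (intro translate_cong arg_cong[where f = "\<lambda>z. z mod (2 * int m)"])
       (auto simp: zigzag_offset_def reflect_def axis_apply algebra_simps)
  have "?lhs = (\<Sum>\<epsilon>\<in>signs n. \<Sum>k<m div 2. (r (reflect j \<epsilon>) k - r \<epsilon> k) + (a \<epsilon> (Suc k) - a \<epsilon> k))"
  proof (rule sum.cong[OF refl], rule sum.cong[OF refl])
    fix \<epsilon> and k assume "\<epsilon> \<in> signs n"
    have "(\<Sum>b\<in>UNIV. g (x \<boxplus> (\<lambda>i. - \<epsilon> i) \<boxplus> zigzag_offset (j, k, b) \<epsilon>, j) - g (x \<boxplus> zigzag_offset (j, k, b) \<epsilon>, j))
        = (r (reflect j \<epsilon>) k - a \<epsilon> k) + (a \<epsilon> (Suc k) - r \<epsilon> k)"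
      by (simp add: UNIV_bool first[OF \<open>\<epsilon> \<in> signs n\<close>] second straight a_def r_def)
    then show "(\<Sum>b\<in>UNIV. g (x \<boxplus> (\<lambda>i. - \<epsilon> i) \<boxplus> zigzag_offset (j, k, b) \<epsilon>, j) - g (x \<boxplus> zigzag_offset (j, k, b) \<epsilon>, j))
        = (r (reflect j \<epsilon>) k - r \<epsilon> k) + (a \<epsilon> (Suc k) - a \<epsilon> k)" by linarith
  qed
  also have "\<dots> = (\<Sum>\<epsilon>\<in>signs n. (\<Sum>k<m div 2. r (reflect j \<epsilon>) k)) - (\<Sum>\<epsilon>\<in>signs n. \<Sum>k<m div 2. r \<epsilon> k)
      + (\<Sum>\<epsilon>\<in>signs n. a \<epsilon> (m div 2) - a \<epsilon> 0)"
    unfolding sum.distrib sum_lessThan_telescope by (simp only: sum_subtractf)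
  also have "\<dots> = (\<Sum>\<epsilon>\<in>signs n. a \<epsilon> (m div 2) - a \<epsilon> 0)"
    using sum_reflect[of "\<lambda>\<epsilon>. \<Sum>k<m div 2. r \<epsilon> k" j] by simp
  also have "\<dots> = (\<Sum>\<epsilon>\<in>signs n. g (x \<boxplus> axis j (- int m), j) - g (x, j))"
  proof (rule sum.cong[OF refl])
    fix \<epsilon> assume "\<epsilon> \<in> signs n"
    have "2 * int (m div 2) = int m" using \<open>even m\<close> by presburger
    then have "x \<boxplus> axis j (- (2 * int (m div 2) * \<epsilon> j)) = x \<boxplus> axis j (- int m)"
      using sign_cases[OF \<open>\<epsilon> \<in> signs n\<close> j] translate_axis_half_turn[of x j] by auto
    moreover have "axis j 0 = (\<lambda>_. 0)" by (auto simp: axis_apply)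
    ultimately show "a \<epsilon> (m div 2) - a \<epsilon> 0 = g (x \<boxplus> axis j (- int m), j) - g (x, j)"
      unfolding a_def using x by (simp add: translate_zero)
  qed
  finally show ?thesis by simp
qed

lemma D_sgn_adj_zigzag_lifting:
  assumes "even m" and x: "x \<in> G"
  shows "D_sgn_adj m n (zigzag_lifting C g) x = C / real m * D_long_adj m n g x"
proof -
  define d where "d \<epsilon> \<iota> =
    g (x \<boxplus> (\<lambda>i. - \<epsilon> i) \<boxplus> zigzag_offset \<iota> \<epsilon>, fst \<iota>) - g (x \<boxplus> zigzag_offset \<iota> \<epsilon>, fst \<iota>)" for \<epsilon> \<iota>
  have "D_sgn_adj m n (zigzag_lifting C g) x =
      (\<Sum>\<epsilon>\<in>signs n. C / real (card zigzag_steps) * (\<Sum>\<iota>\<in>zigzag_steps. d \<epsilon> \<iota>)) / 2 ^ n"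
    unfolding D_sgn_adj_eq[OF x] zigzag_lifting_def d_def
    by (intro arg_cong2[of _ _ _ _ "(/)"] sum.cong refl)
       (simp add: sum_subtractf right_diff_distrib diff_divide_distrib)
  also have "\<dots> = C / real (card zigzag_steps) * (\<Sum>\<epsilon>\<in>signs n. \<Sum>\<iota>\<in>zigzag_steps. d \<epsilon> \<iota>) / 2 ^ n"
    by (simp add: sum_distrib_left)
  also have "(\<Sum>\<epsilon>\<in>signs n. \<Sum>\<iota>\<in>zigzag_steps. d \<epsilon> \<iota>) =
      (\<Sum>\<epsilon>\<in>signs n. \<Sum>j\<in>{1..n}. \<Sum>k<m div 2. \<Sum>b\<in>UNIV. d \<epsilon> (j, k, b))"
    unfolding zigzag_steps_def by (simp only: sum.cartesian_product case_prod_unfold prod.collapse)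
  also have "\<dots> = (\<Sum>j\<in>{1..n}. \<Sum>\<epsilon>\<in>signs n. \<Sum>k<m div 2. \<Sum>b\<in>UNIV. d \<epsilon> (j, k, b))"
    by (rule sum.swap)
  also have "\<dots> = (\<Sum>j\<in>{1..n}. 2 ^ n * (g (x \<boxplus> axis j (- int m), j) - g (x, j)))"
    unfolding d_def using zigzag_telescope[OF _ x \<open>even m\<close>] by (intro sum.cong) auto
  also have "\<dots> = 2 ^ n * (real n * D_long_adj m n g x)"
    using n_pos by (simp add: D_long_adj_eq[OF x] flip: sum_distrib_left)
  finally show ?thesis
    using n_pos by (simp add: card_zigzag_steps[OF \<open>even m\<close>])
qed

lemma linear_lifting_zigzag:
  assumes "even m"
  shows "linear_lifting m n q (zigzag_lifting (real n powr (1 / q)))"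
  unfolding linear_lifting_def
proof (intro conjI allI ballI)
  show "linear_operator_on (long_dom m n) (sgn_dom m n) (zigzag_lifting (real n powr (1 / q)))"
    unfolding linear_operator_on_def
  proof (intro conjI allI impI ballI)
    fix f g :: "(nat \<Rightarrow> int) \<times> nat \<Rightarrow> real" and \<omega>' :: "(nat \<Rightarrow> int) \<times> (nat \<Rightarrow> int)"
    assume fg: "\<forall>\<omega>\<in>long_dom m n. f \<omega> = g \<omega>"
    obtain y \<epsilon> where \<omega>': "\<omega>' = (y, \<epsilon>)" by fastforce
    have "(\<Sum>\<iota>\<in>zigzag_steps. f (y \<boxplus> zigzag_offset \<iota> \<epsilon>, fst \<iota>)) =
        (\<Sum>\<iota>\<in>zigzag_steps. g (y \<boxplus> zigzag_offset \<iota> \<epsilon>, fst \<iota>))"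
      using fg by (intro sum.cong) (auto simp: zigzag_steps_def)
    then show "zigzag_lifting (real n powr (1 / q)) f \<omega>' = zigzag_lifting (real n powr (1 / q)) g \<omega>'"
      unfolding \<omega>' zigzag_lifting_def by simp
  qed (auto simp: zigzag_lifting_def sum.distrib add_divide_distrib distrib_left simp flip: sum_distrib_left)
qed (rule D_sgn_adj_zigzag_lifting[OF assms])

text \<open>For fixed \<epsilon> and index, the offset is a translation of the torus, hence preserves the measure, and the
directions j are averaged uniformly. So Jensen's inequality shows that the average is a contraction.\<close>

lemma power_mean_zigzag_average_le:
  assumes r: "1 \<le> r" and "0 \<le> C" and "2 \<le> m" and \<phi>: "\<And>\<omega>. 0 \<le> \<phi> \<omega>" and \<psi>: "\<And>\<omega>. 0 \<le> \<psi> \<omega>"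
    and le: "\<And>\<omega>. \<psi> \<omega> \<le> zigzag_lifting C \<phi> \<omega>"
  shows "power_mean r (sgn_dom m n) \<psi> \<le> C * power_mean r (long_dom m n) \<phi>"
proof -
  have ne: "zigzag_steps \<noteq> {}" "0 < card zigzag_steps"
    using n_pos \<open>2 \<le> m\<close> finite_zigzag_steps
    by (auto simp: zigzag_steps_def card_gt_0_iff lessThan_empty_iff)
  show ?thesis
  proof (cases r)
    case (real \<rho>)
    then have "1 \<le> \<rho>" using r by simp
    have pointwise: "\<psi> \<omega> powr \<rho> \<le> C powr \<rho> * zigzag_lifting 1 (\<lambda>\<omega>. \<phi> \<omega> powr \<rho>) \<omega>" for \<omega>
    proof -
      obtain y \<epsilon> where \<omega>: "\<omega> = (y, \<epsilon>)" by fastforce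
      have "\<psi> \<omega> powr \<rho> \<le> zigzag_lifting C \<phi> \<omega> powr \<rho>"
        using le \<psi> \<open>1 \<le> \<rho>\<close> by (intro powr_mono2) auto
      also have "\<dots> = C powr \<rho> * ((\<Sum>\<iota>\<in>zigzag_steps. \<phi> (y \<boxplus> zigzag_offset \<iota> \<epsilon>, fst \<iota>)) / real (card zigzag_steps)) powr \<rho>"
        using \<open>0 \<le> C\<close> \<phi> unfolding \<omega> zigzag_lifting_def prod.case by (intro powr_mult)
      also have "\<dots> \<le> C powr \<rho> * zigzag_lifting 1 (\<lambda>\<omega>. \<phi> \<omega> powr \<rho>) \<omega>"
        using powr_average_le[OF \<open>1 \<le> \<rho>\<close> finite_zigzag_steps ne(1)] \<phi>
        unfolding \<omega> zigzag_lifting_def by (intro mult_left_mono) auto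
      finally show ?thesis .
    qed
    have "(\<Sum>\<omega>\<in>sgn_dom m n. zigzag_lifting 1 v \<omega>) = 2 ^ n * ((\<Sum>\<omega>\<in>long_dom m n. v \<omega>) / real n)" for v
    proof -
      have line: "(\<Sum>\<iota>\<in>zigzag_steps. \<Sum>y\<in>G. v (y \<boxplus> zigzag_offset \<iota> \<epsilon>, fst \<iota>))
          = real (card zigzag_steps) * ((\<Sum>\<omega>\<in>long_dom m n. v \<omega>) / real n)" for \<epsilon>
      proof -
        have "(\<Sum>\<iota>\<in>zigzag_steps. \<Sum>y\<in>G. v (y \<boxplus> zigzag_offset \<iota> \<epsilon>, fst \<iota>)) = (\<Sum>\<iota>\<in>zigzag_steps. \<Sum>y\<in>G. v (y, fst \<iota>))"
          by (intro sum.cong[OF refl, where A = zigzag_steps]) (rule sum_translate[of "\<lambda>y. v (y, fst \<iota>)" for \<iota>])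
        also have "\<dots> = real (card ({..<m div 2} \<times> (UNIV :: bool set))) * (\<Sum>j\<in>{1..n}. \<Sum>y\<in>G. v (y, j))"
          unfolding zigzag_steps_def sum.cartesian_product'[of _ "{1..n}"] by (simp add: sum_distrib_left)
        also have "(\<Sum>j\<in>{1..n}. \<Sum>y\<in>G. v (y, j)) = (\<Sum>\<omega>\<in>long_dom m n. v \<omega>)"
          by (subst sum.swap) (simp add: sum.cartesian_product)
        finally show ?thesis
          using n_pos by (simp add: zigzag_steps_def card_cartesian_product)
      qed
      have "(\<Sum>\<omega>\<in>sgn_dom m n. zigzag_lifting 1 v \<omega>) =
          (\<Sum>\<epsilon>\<in>signs n. \<Sum>y\<in>G. zigzag_lifting 1 v (y, \<epsilon>))"
        by (subst sum.swap) (simp add: sum.cartesian_product)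
      also have "\<dots> = (\<Sum>\<epsilon>\<in>signs n. (\<Sum>\<iota>\<in>zigzag_steps. \<Sum>y\<in>G. v (y \<boxplus> zigzag_offset \<iota> \<epsilon>, fst \<iota>)) / real (card zigzag_steps))"
        unfolding zigzag_lifting_def prod.case mult_1 sum_divide_distrib[symmetric]
        by (subst sum.swap) (rule refl)
      also have "\<dots> = 2 ^ n * ((\<Sum>\<omega>\<in>long_dom m n. v \<omega>) / real n)"
        unfolding line using ne by simp
      finally show ?thesis .
    qed
    moreover have "(\<Sum>\<omega>\<in>sgn_dom m n. \<psi> \<omega> powr \<rho>)
        \<le> (\<Sum>\<omega>\<in>sgn_dom m n. C powr \<rho> * zigzag_lifting 1 (\<lambda>\<omega>. \<phi> \<omega> powr \<rho>) \<omega>)"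
      by (intro sum_mono pointwise)
    ultimately have "(\<Sum>\<omega>\<in>sgn_dom m n. \<psi> \<omega> powr \<rho>)
        \<le> C powr \<rho> * (2 ^ n * ((\<Sum>\<omega>\<in>long_dom m n. \<phi> \<omega> powr \<rho>) / real n))"
      by (simp flip: sum_distrib_left)
    then show ?thesis
      using finite_torus torus_nonempty \<open>0 \<le> C\<close> \<open>1 \<le> \<rho>\<close> n_pos unfolding real
      by (intro power_mean_ereal_le)
         (auto simp: card_cartesian_product divide_le_eq card_gt_0_iff field_simps)
  next
    case PInf
    show ?thesis
      unfolding PInf
    proof (rule power_mean_infinity_le)
      show "finite (sgn_dom m n)" "sgn_dom m n \<noteq> {}" "finite (long_dom m n)"
        using finite_torus torus_nonempty by auto
      show "\<psi> \<omega>' \<le> C * M" if "\<And>\<omega>. \<omega> \<in> long_dom m n \<Longrightarrow> \<phi> \<omega> \<le> M" for M \<omega>'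
      proof -
        obtain y \<epsilon> where \<omega>': "\<omega>' = (y, \<epsilon>)" by fastforce
        have "(\<Sum>\<iota>\<in>zigzag_steps. \<phi> (y \<boxplus> zigzag_offset \<iota> \<epsilon>, fst \<iota>)) \<le> real (card zigzag_steps) * M"
          by (intro sum_bounded_above that) (auto simp: zigzag_steps_def)
        then have "zigzag_lifting C \<phi> \<omega>' \<le> C * M"
          using ne \<open>0 \<le> C\<close> unfolding \<omega>' zigzag_lifting_def prod.case
          by (intro mult_left_mono) (simp_all add: divide_le_eq mult.commute)
        then show ?thesis using le[of \<omega>'] by simp
      qed
    qed
  qed (use r in auto)
qed

lemma linf_norm_zigzag_lifting_le:
  assumes "1 \<le> N" and "0 \<le> C"
  shows "linf_norm N (coordinatewise (zigzag_lifting C) F \<omega>) \<le> zigzag_lifting C (\<lambda>\<omega>. linf_norm N (F \<omega>)) \<omega>"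
proof (rule linf_norm_le[OF \<open>1 \<le> N\<close>])
  fix i assume i: "1 \<le> i" "i \<le> N"
  obtain y \<epsilon> where \<omega>: "\<omega> = (y, \<epsilon>)" by fastforce
  have "\<bar>\<Sum>\<iota>\<in>zigzag_steps. F (y \<boxplus> zigzag_offset \<iota> \<epsilon>, fst \<iota>) i\<bar>
      \<le> (\<Sum>\<iota>\<in>zigzag_steps. linf_norm N (F (y \<boxplus> zigzag_offset \<iota> \<epsilon>, fst \<iota>)))"
    by (rule order_trans[OF sum_abs sum_mono]) (rule abs_le_linf_norm[OF i])
  then show "\<bar>coordinatewise (zigzag_lifting C) F \<omega> i\<bar> \<le> zigzag_lifting C (\<lambda>\<omega>. linf_norm N (F \<omega>)) \<omega>"
    using \<open>0 \<le> C\<close> unfolding coordinatewise_def \<omega> zigzag_lifting_def prod.case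
    by (simp add: abs_mult mult_left_mono divide_right_mono)
qed

lemma regular_norm_zigzag_lifting_le:
  assumes r: "1 \<le> r" and "0 \<le> C" and "2 \<le> m"
  shows "regular_norm r (long_dom m n) (sgn_dom m n) (zigzag_lifting C) \<le> ereal C"
  unfolding regular_norm_def operator_norm_def
proof (intro SUP_least)
  fix N :: nat and F :: "(nat \<Rightarrow> int) \<times> nat \<Rightarrow> nat \<Rightarrow> real"
  assume "N \<in> {1..}" and "F \<in> {F. Lr_norm r N (long_dom m n) F \<le> 1}"
  then have N: "1 \<le> N" and F: "power_mean r (long_dom m n) (\<lambda>\<omega>. linf_norm N (F \<omega>)) \<le> 1"
    by (auto simp: Lr_norm_eq_power_mean)
  have "Lr_norm r N (sgn_dom m n) (coordinatewise (zigzag_lifting C) F)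
      \<le> C * power_mean r (long_dom m n) (\<lambda>\<omega>. linf_norm N (F \<omega>))"
    unfolding Lr_norm_eq_power_mean
    using linf_norm_nonneg[OF N] linf_norm_zigzag_lifting_le[OF N \<open>0 \<le> C\<close>] \<open>2 \<le> m\<close> \<open>0 \<le> C\<close>
    by (intro power_mean_zigzag_average_le[OF r]) auto
  also have "\<dots> \<le> C" using F \<open>0 \<le> C\<close> by (simp add: mult_left_le)
  finally show "ereal (Lr_norm r N (sgn_dom m n) (coordinatewise (zigzag_lifting C) F)) \<le> ereal C" by simp
qed

lemma least_regular_norm:
  assumes "1 \<le> r" and "even m"
  shows "least_regular_norm_of_linear_lifting m n q r (ereal (real n powr (1 / q)))"
proof -
  have "2 \<le> m" using m_pos \<open>even m\<close> by presburger
  then have "regular_norm r (long_dom m n) (sgn_dom m n) (zigzag_lifting (real n powr (1 / q)))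
      = ereal (real n powr (1 / q))"
    using assms linear_lifting_zigzag regular_norm_linear_lifting_ge regular_norm_zigzag_lifting_le
    by (intro antisym) auto
  then show ?thesis
    unfolding least_regular_norm_of_linear_lifting_def
    using linear_lifting_zigzag[OF \<open>even m\<close>] regular_norm_linear_lifting_ge[OF _ \<open>1 \<le> r\<close>] by auto
qed

end

theorem corollary1p5:
  fixes n m :: nat and p q :: real
  assumes "1 \<le> n"
    and "2 \<le> q"
    and "1 \<le> p" and "p \<le> q"
    and "4 \<le> m" and "even m"
    and "real n \<le> real m powr q"
  shows "bounded_lifting m n q (conj_exponent p) 22
    \<and> least_regular_norm_of_linear_lifting m n q (conj_exponent p) (ereal (real n powr (1 / q)))
    \<and> (p = 2 \<and> q = 2 \<longrightarrow>
         least_regular_norm_of_linear_lifting m n 2 2 (ereal (sqrt (real n)))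
         \<and> bounded_lifting m n 2 2 22)"
proof -
  interpret discrete_torus m n
    using assms by unfold_locales auto
  have lifting: "bounded_lifting m n q (conj_exponent p) 22"
    using assms by (intro bounded_lifting_22)
  have "1 \<le> conj_exponent p"
    using assms by (auto simp: conj_exponent_def one_ereal_def field_simps)
  then have least: "least_regular_norm_of_linear_lifting m n q (conj_exponent p) (ereal (real n powr (1 / q)))"
    using \<open>even m\<close> by (rule least_regular_norm)
  have "conj_exponent 2 = 2" by (simp add: conj_exponent_def)
  moreover have "real n powr (1 / 2) = sqrt (real n)" by (simp add: powr_half_sqrt)
  ultimately show ?thesis
    using lifting least by auto
qed

end
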